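(* There exists a constant $C>0$ such that for every weight $w$ on $\mathbb{R}^2$, every locally integrable function $f$ on $\mathbb{R}^2$ and every $t>0$, with $W=\mathfrak{M}_{\mathcal{R}}\mathfrak{M}_{\mathcal{Q}}w$ (i.e. $W=\mathfrak{M}_{\mathcal{R}}(\mathfrak{M}_{\mathcal{Q}}w)$), $$ w(\{x\in\mathbb{R}^2:\ \mathfrak{M}_{\mathcal{R}}f(x)>t\}) \le C\int_{\mathbb{R}^2}\frac{|f(x)|}{t}\left(1+\log^{+}\frac{|f(x)|}{t}\right)W(x)\,dx . $$ The constant $C$ does not depend on $w$ and $f$ (nor on $t$).
   Context: A weight on $\mathbb{R}^2$ is a non-negative locally integrable function on $\mathbb{R}^2$. For a measurable set $E$, $w(E)=\int_E w(x)\,dx$, $|E|$ is the Lebesgue measure of $E$, and $\mathbf{1}_E$ is its characteristic function. $\log^{+}t=\max(0,\log t)$ (so $\log^+ 0=0$). $\mathcal{Q}$ is the set of all cubes (squares) in $\mathbb{R}^2$, with sides not necessarily parallel to the axes. The Hardy-Littlewood maximal operator is $$\mathfrak{M}_{\mathcal{Q}}f(x)=\sup_{Q\in\mathcal{Q}}\mathbf{1}_Q(x)\frac{1}{|Q|}\int_Q|f(y)|\,dy .$$ $\mathcal{R}$ is the set of all rectangles in $\mathbb{R}^2$ with sides parallel to the coordinate axes. The strong maximal operator is $$\mathfrak{M}_{\mathcal{R}}f(x)=\sup_{R\in\mathcal{R}}\mathbf{1}_R(x)\frac{1}{|R|}\int_R|f(y)|\,dy .$$ The same formulas are used for arbitrary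 non-negative measurable functions with values in $[0,\infty]$, such as $\mathfrak{M}_{\mathcal{Q}}w$; integrals of non-negative functions take values in $[0,\infty]$, with the convention $0\cdot\infty=0$. *)

theory Defs
  imports "HOL-Analysis.Analysis"
begin

text \<open>The plane is \<^typ>\<open>real \<times> real\<close>, with its Euclidean norm and Lebesgue measure.\<close>

type_synonym plane = "real \<times> real"

definition locally_integrable :: "(plane \<Rightarrow> real) \<Rightarrow> bool" where
  "locally_integrable f \<longleftrightarrow> (\<forall>K. compact K \<longrightarrow> f absolutely_integrable_on K)"

definition weight :: "(plane \<Rightarrow> real) \<Rightarrow> bool" where
  "weight w \<longleftrightarrow> (\<forall>x. 0 \<le> w x) \<and> locally_integrable w"

definition weight_of :: "(plane \<Rightarrow> real) \<Rightarrow> plane set \<Rightarrow> ennreal" where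
  "weight_of w E = (\<integral>\<^sup>+x\<in>E. ennreal (w x) \<partial>lebesgue)"

text \<open>Cubes and rectangles are closed and non-degenerate. Every cube is the image of an
  axis-parallel one under a linear isometry, because axis-parallel cubes may have any position.\<close>

definition cubes :: "plane set set" where
  "cubes = {h ` ({a..a+l} \<times> {b..b+l}) |
     (h :: plane \<Rightarrow> plane) a b l. orthogonal_transformation h \<and> 0 < l}"

definition rectangles :: "plane set set" where
  "rectangles = {{a..b} \<times> {c..d} | a b c d. a < b \<and> c < d}"

definition maximal_operator :: "plane set set \<Rightarrow> (plane \<Rightarrow> ennreal) \<Rightarrow> plane \<Rightarrow> ennreal" where
  "maximal_operator \<B> g x =
     (SUP B\<in>\<B>. indicator B x * ((\<integral>\<^sup>+y\<in>B. g y \<partial>lebesgue) / emeasure lebesgue B))"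

abbreviation HL_maximal :: "(plane \<Rightarrow> ennreal) \<Rightarrow> plane \<Rightarrow> ennreal" where
  "HL_maximal \<equiv> maximal_operator cubes"

abbreviation strong_maximal :: "(plane \<Rightarrow> ennreal) \<Rightarrow> plane \<Rightarrow> ennreal" where
  "strong_maximal \<equiv> maximal_operator rectangles"

definition log_plus :: "real \<Rightarrow> real" where
  "log_plus s = max 0 (ln s)"

text \<open>On \<^term>\<open>{0..}\<close> this is the usual function, since \<^prop>\<open>ln (0::real) = 0\<close>.\<close>

end

theory Submission
  imports Defs
begin

text \<open>
  Write \<open>U\<close> for the maximal function of \<open>w\<close> over axis-parallel squares, and \<open>W\<close> for the right-hand
  weight. By a countability argument it suffices to bound \<open>w(\<Union>F)\<close> for a finite family \<open>F\<close> of
  rectangles with \<open>\<integral>\<^sub>R |f|/t \<ge> |R|\<close>.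

  The key estimate is that \<open>w(\<Union>F) \<le> C \<lambda> |\<Union>F|\<close> whenever \<open>\<integral>\<^bsub>3R\<^esub> U \<le> \<lambda> |R|\<close> on \<open>F\<close>. Let all rectangles be at
  least as wide as high, and select a sparse subfamily greedily in the order of decreasing width.
  Inside a rectangle \<open>I \<times> J\<close>, the selected rectangles that it meets, tripled horizontally,
  contain full horizontal strips, whose heights cover half of \<open>J\<close>. Hence \<open>I \<times> J\<close> is a union of squares
  of side \<open>|J|\<close> that are half covered by the tripled selected rectangles, and a Vitali
  argument for squares bounds \<open>w(\<Union>F)\<close> by the \<open>U\<close>-mass of the latter, hence by \<open>\<lambda>\<close> times the sum of their areas.

  Grouping the rectangles by the size \<open>\<lambda> = 2\<^sup>k\<close> of the averages of \<open>U\<close> and applying the unweighted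
  \<open>L log L\<close> estimate for the strong maximal function to \<open>f\<close> restricted to the union of each group gives the theorem,
  because the powers \<open>2\<^sup>k\<close> of the groups that cover a given point \<open>x\<close> add up to at most \<open>C W(x)\<close>.
\<close>

section \<open>Coverings by squares\<close>

text \<open>Indices enter in order of decreasing \<open>r\<close>. A new \<open>X i\<close> that
  meets a selected \<open>X j\<close> has \<open>r i \<le> r j\<close> and so lies in
  \<open>Y j\<close>; otherwise \<open>i\<close> is selected. The sets are abstract so that the
  lemma serves both squares and intervals, with \<open>Y\<close> the threefold enlargement.\<close>

lemma finite_vitali:
  fixes X Y :: "'i \<Rightarrow> 'a set" and r :: "'i \<Rightarrow> real"
  assumes "finite F"
    and expand: "\<And>i j. i \<in> F \<Longrightarrow> j \<in> F \<Longrightarrow> r i \<le> r j \<Longrightarrow> X i \<inter> X j \<noteq> {} \<Longrightarrow> X i \<subseteq> Y j"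
  obtains S where "S \<subseteq> F" "disjoint_family_on X S" "(\<Union>i\<in>F. X i) \<subseteq> (\<Union>i\<in>S. Y i)"
proof -
  have "\<exists>S\<subseteq>F. disjoint_family_on X S \<and> (\<Union>i\<in>F. X i) \<subseteq> (\<Union>i\<in>S. Y i)"
    using assms
  proof (induction F rule: finite_ranking_induct[where f = "\<lambda>i. - r i"])
    case empty
    then show ?case by (auto simp: disjoint_family_on_def)
  next
    case (insert i F)
    then obtain S where S: "S \<subseteq> F" "disjoint_family_on X S" "(\<Union>i\<in>F. X i) \<subseteq> (\<Union>i\<in>S. Y i)"
      by (metis insertCI)
    show ?case
    proof (cases "\<exists>j\<in>S. X i \<inter> X j \<noteq> {}")
      case True
      then obtain j where j: "j \<in> S" "X i \<inter> X j \<noteq> {}" by blast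
      with S insert have "X i \<subseteq> Y j" by (metis insertCI neg_le_iff_le subsetD)
      with S j show ?thesis by (intro exI[of _ S]) auto
    next
      case False
      \<comment> \<open>A nonempty \<open>X i\<close> meets itself, so the expansion hypothesis
        applies with both indices equal.\<close>
      have "X i \<subseteq> Y i"
        using insert.prems[of i i] by (cases "X i = {}") auto
      with S False show ?thesis
        by (intro exI[of _ "insert i S"]) (auto simp: disjoint_family_on_def)
    qed
  qed
  then show thesis using that by blast
qed

lemma nn_integral_UN_le:
  assumes "finite F" "f \<in> borel_measurable M" "\<And>i. i \<in> F \<Longrightarrow> A i \<in> sets M"
  shows "(\<integral>\<^sup>+x\<in>(\<Union>i\<in>F. A i). f x \<partial>M) \<le> (\<Sum>i\<in>F. \<integral>\<^sup>+x\<in>A i. f x \<partial>M)"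
proof -
  have "(\<integral>\<^sup>+x\<in>(\<Union>i\<in>F. A i). f x \<partial>M) \<le> (\<integral>\<^sup>+x. (\<Sum>i\<in>F. f x * indicator (A i) x) \<partial>M)"
  proof (rule nn_integral_mono)
    fix x
    show "f x * indicator (\<Union>i\<in>F. A i) x \<le> (\<Sum>i\<in>F. f x * indicator (A i) x)"
    proof (cases "\<exists>i\<in>F. x \<in> A i")
      case True
      then obtain i where i: "i \<in> F" "x \<in> A i" by blast
      have "f x = f x * indicator (A i) x" using i by simp
      also have "\<dots> \<le> (\<Sum>i\<in>F. f x * indicator (A i) x)"
        by (rule member_le_sum[OF i(1)]) (use assms in auto)
      finally show ?thesis using i by (auto simp: indicator_def)
    qed auto
  qed
  also have "\<dots> = (\<Sum>i\<in>F. \<integral>\<^sup>+x\<in>A i. f x \<partial>M)"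
    using assms by (intro nn_integral_sum) auto
  finally show ?thesis .
qed

lemma nn_integral_disjoint_UN:
  assumes "finite F" "f \<in> borel_measurable M" "\<And>i. i \<in> F \<Longrightarrow> A i \<in> sets M" "disjoint_family_on A F"
  shows "(\<Sum>i\<in>F. \<integral>\<^sup>+x\<in>A i. f x \<partial>M) = (\<integral>\<^sup>+x\<in>(\<Union>i\<in>F. A i). f x \<partial>M)"
proof -
  have "(\<Sum>i\<in>F. \<integral>\<^sup>+x\<in>A i. f x \<partial>M) = (\<integral>\<^sup>+x. (\<Sum>i\<in>F. f x * indicator (A i) x) \<partial>M)"
    using assms by (intro nn_integral_sum[symmetric]) auto
  also have "\<dots> = (\<integral>\<^sup>+x\<in>(\<Union>i\<in>F. A i). f x \<partial>M)"
    using assms by (simp add: sum_distrib_left[symmetric] indicator_UN_disjoint)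
  finally show ?thesis .
qed

lemma emeasure_rectangle:
  "a \<le> b \<Longrightarrow> c \<le> d \<Longrightarrow> emeasure lborel ({a..b::real} \<times> {c..d::real}) = ennreal ((b - a) * (d - c))"
  by (simp add: lborel_prod[symmetric] lborel.emeasure_pair_measure_Times ennreal_mult)

lemma sets_rectangle [measurable, simp]: "{a..b::real} \<times> {c..d::real} \<in> sets borel"
  by (intro borel_closed closed_Times) auto

text \<open>The tripled Vitali squares \<open>T i\<close> cover the union. By \<open>sq\<close>, the
  \<open>w\<close>-mass of \<open>T i\<close> is at most \<open>9 * (l i)^2 * U x\<close> at every
  point \<open>x\<close> of \<open>Q i\<close>. Averaging over \<open>Q i \<inter> E\<close>, which
  has at least half the area of \<open>Q i\<close>, bounds it by 18 times the integral of
  \<open>U\<close> there. The selected \<open>Q i\<close> are disjoint, so these integrals add up to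
  at most the one over \<open>E\<close>.\<close>

lemma square_covering:
  fixes p q l :: "'i \<Rightarrow> real" and w U :: "plane \<Rightarrow> ennreal"
  assumes F: "finite F" "\<And>i. i \<in> F \<Longrightarrow> 0 < l i"
    and [measurable]: "w \<in> borel_measurable borel" "U \<in> borel_measurable borel" "E \<in> sets borel"
    and sq: "\<And>a b l x. 0 < l \<Longrightarrow> x \<in> {a..a+l} \<times> {b..b+l} \<Longrightarrow>
      (\<integral>\<^sup>+y\<in>{a..a+l} \<times> {b..b+l}. w y \<partial>lborel) \<le> ennreal (l^2) * U x"
    and half: "\<And>i. i \<in> F \<Longrightarrow>
      ennreal ((l i)^2) \<le> 2 * emeasure lborel (({p i..p i+l i} \<times> {q i..q i+l i}) \<inter> E)"
  shows "(\<integral>\<^sup>+y\<in>(\<Union>i\<in>F. {p i..p i+l i} \<times> {q i..q i+l i}). w y \<partial>lborel) \<le> 18 * (\<integral>\<^sup>+y\<in>E. U y \<partial>lborel)"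
proof -
  define Q where "Q i = {p i..p i+l i} \<times> {q i..q i+l i}" for i
  define T where "T i = {p i - l i..p i - l i + 3 * l i} \<times> {q i - l i..q i - l i + 3 * l i}" for i
  have [measurable]: "Q i \<in> sets borel" "T i \<in> sets borel" for i by (simp_all add: Q_def T_def)
  obtain S where S: "S \<subseteq> F" "disjoint_family_on Q S" "(\<Union>i\<in>F. Q i) \<subseteq> (\<Union>i\<in>S. T i)"
  proof (rule finite_vitali[of F l Q T])
    fix i j assume "i \<in> F" "j \<in> F" "l i \<le> l j" "Q i \<inter> Q j \<noteq> {}"
    then show "Q i \<subseteq> T j" by (auto simp: Q_def T_def)
  qed (use F in auto)
  have "finite S" using S F finite_subset by blast
  have T: "(\<integral>\<^sup>+y\<in>T i. w y \<partial>lborel) \<le> 18 * (\<integral>\<^sup>+y\<in>Q i \<inter> E. U y \<partial>lborel)" if "i \<in> S" for i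
  proof -
    have li: "0 < l i" using that S F by blast
    let ?L = "ennreal ((l i)^2)" and ?I = "\<integral>\<^sup>+y\<in>T i. w y \<partial>lborel" and ?J = "\<integral>\<^sup>+y\<in>Q i \<inter> E. U y \<partial>lborel"
    have "?I * emeasure lborel (Q i \<inter> E) = (\<integral>\<^sup>+x\<in>Q i \<inter> E. ?I \<partial>lborel)"
      by (simp add: nn_integral_cmult)
    also have "\<dots> \<le> (\<integral>\<^sup>+x\<in>Q i \<inter> E. ennreal ((3 * l i)^2) * U x \<partial>lborel)"
    proof (intro nn_integral_mono)
      fix x
      show "?I * indicator (Q i \<inter> E) x \<le> ennreal ((3 * l i)^2) * U x * indicator (Q i \<inter> E) x"
        using sq[of "3 * l i" x "p i - l i" "q i - l i"] li
        by (auto simp: T_def Q_def indicator_def)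
    qed
    also have "\<dots> = ennreal ((3 * l i)^2) * ?J"
      by (simp add: nn_integral_cmult mult.assoc)
    also have "\<dots> = 9 * ?L * ?J"
      by (simp add: power_mult_distrib ennreal_mult)
    finally have 1: "?I * emeasure lborel (Q i \<inter> E) \<le> 9 * ?L * ?J" .
    have "?L * ?I \<le> 2 * emeasure lborel (Q i \<inter> E) * ?I"
      using half[of i] that S by (intro mult_right_mono) (auto simp: Q_def)
    also have "\<dots> \<le> 2 * (9 * ?L * ?J)"
      using mult_left_mono[OF 1, of 2] by (simp add: mult_ac)
    also have "\<dots> = ?L * (18 * ?J)" by (simp add: mult_ac)
    finally show ?thesis using li
      by (subst (asm) ennreal_mult_le_mult_iff) auto
  qed
  have "(\<integral>\<^sup>+y\<in>(\<Union>i\<in>F. Q i). w y \<partial>lborel) \<le> (\<integral>\<^sup>+y\<in>(\<Union>i\<in>S. T i). w y \<partial>lborel)"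
    using S by (intro nn_set_integral_set_mono) auto
  also have "\<dots> \<le> (\<Sum>i\<in>S. \<integral>\<^sup>+y\<in>T i. w y \<partial>lborel)"
    using \<open>finite S\<close> by (intro nn_integral_UN_le) auto
  also have "\<dots> \<le> (\<Sum>i\<in>S. 18 * (\<integral>\<^sup>+y\<in>Q i \<inter> E. U y \<partial>lborel))"
    by (intro sum_mono T)
  also have "\<dots> = 18 * (\<integral>\<^sup>+y\<in>(\<Union>i\<in>S. Q i \<inter> E). U y \<partial>lborel)"
    using \<open>finite S\<close> S(2)
    by (subst nn_integral_disjoint_UN[symmetric]) (auto simp: sum_distrib_left disjoint_family_on_def)
  also have "\<dots> \<le> 18 * (\<integral>\<^sup>+y\<in>E. U y \<partial>lborel)"
    by (intro mult_left_mono nn_set_integral_set_mono) auto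
  finally show ?thesis by (simp add: Q_def)
qed

section \<open>Rectangles on which \<open>U\<close> has bounded averages\<close>

text \<open>A rectangle is selected only if the heights of the selected rectangles that are at least
  as wide and meet it cover less than half of its own height. Then at least half of its area is new,
  which gives the factor 2 in the area bound. A rejected rectangle satisfies the height condition by
  this rule, a selected one because it meets itself.\<close>

lemma rectangle_selection:
  fixes a b c d :: "'i \<Rightarrow> real"
  assumes F: "finite F" "\<And>i. i \<in> F \<Longrightarrow> a i < b i" "\<And>i. i \<in> F \<Longrightarrow> c i < d i"
  defines "R \<equiv> \<lambda>i. {a i..b i} \<times> {c i..d i}"
  obtains S where "S \<subseteq> F"
    "(\<Sum>i\<in>S. ennreal ((b i - a i) * (d i - c i))) \<le> 2 * emeasure lborel (\<Union>i\<in>S. R i)"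
    "\<And>i. i \<in> F \<Longrightarrow> ennreal (d i - c i) \<le> 2 * emeasure lborel
      ({c i..d i} \<inter> (\<Union>j\<in>{j\<in>S. b i - a i \<le> b j - a j \<and> R i \<inter> R j \<noteq> {}}. {c j..d j}))"
proof -
  define V where "V S i = {c i..d i} \<inter> (\<Union>j\<in>{j\<in>S. b i - a i \<le> b j - a j \<and> R i \<inter> R j \<noteq> {}}. {c j..d j})" for S i
  \<comment> \<open>Later selections only enlarge \<open>V S i\<close>, so a height condition once
    reached persists.\<close>
  have V_mono: "emeasure lborel (V S i) \<le> emeasure lborel (V S' i)" if "S \<subseteq> S'" "finite S'" for S S' i
    using that finite_subset[OF that] unfolding V_def
    by (intro emeasure_mono) (auto intro!: sets.finite_UN)
  have R[measurable]: "R i \<in> sets borel" for i by (simp add: R_def)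
  have "\<exists>S\<subseteq>F. (\<Sum>i\<in>S. ennreal ((b i - a i) * (d i - c i))) \<le> 2 * emeasure lborel (\<Union>i\<in>S. R i)
      \<and> (\<forall>i\<in>F. ennreal (d i - c i) \<le> 2 * emeasure lborel (V S i))"
    using F
  proof (induction F rule: finite_ranking_induct[where f = "\<lambda>i. - (b i - a i)"])
    case empty
    then show ?case by auto
  next
    case (insert i F)
    have "\<exists>S\<subseteq>F. (\<Sum>i\<in>S. ennreal ((b i - a i) * (d i - c i))) \<le> 2 * emeasure lborel (\<Union>i\<in>S. R i)
        \<and> (\<forall>i\<in>F. ennreal (d i - c i) \<le> 2 * emeasure lborel (V S i))"
      by (rule insert.IH) (use insert.prems in auto)
    then obtain S where S: "S \<subseteq> F"
      "(\<Sum>i\<in>S. ennreal ((b i - a i) * (d i - c i))) \<le> 2 * emeasure lborel (\<Union>i\<in>S. R i)"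
      "\<forall>i\<in>F. ennreal (d i - c i) \<le> 2 * emeasure lborel (V S i)"
      by blast
    have fin: "finite S" using S insert finite_subset by blast
    have i: "a i < b i" "c i < d i" using insert by auto
    show ?case
    proof (cases "ennreal (d i - c i) \<le> 2 * emeasure lborel (V S i)")
      case True
      with S show ?thesis by (intro exI[of _ S]) auto
    next
      case False
      let ?E = "\<Union>j\<in>S. R j"
      \<comment> \<open>If \<open>i\<close> were selected already, \<open>R i\<close> would meet
        itself and \<open>V S i\<close> would be the whole side.\<close>
      have "i \<notin> S" using False
      proof (rule contrapos_nn)
        assume "i \<in> S"
        then have "V S i = {c i..d i}" using i by (auto simp: V_def R_def)
        then have "emeasure lborel (V S i) = ennreal (d i - c i)" using i by simp
        then show "ennreal (d i - c i) \<le> 2 * emeasure lborel (V S i)"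
          by (simp add: mult_2)
      qed
      have V[measurable]: "V S i \<in> sets borel"
        unfolding V_def using fin by (auto intro!: sets.finite_UN)
      \<comment> \<open>A point of the overlap lies in some selected \<open>R j\<close>, which is at
        least as wide as \<open>R i\<close> by the processing order; so its second coordinate
        belongs to \<open>V S i\<close>.\<close>
      have sub: "R i \<inter> ?E \<subseteq> {a i..b i} \<times> V S i"
      proof
        fix x assume x: "x \<in> R i \<inter> ?E"
        then obtain j where j: "j \<in> S" "x \<in> R j" by blast
        with S insert have "b i - a i \<le> b j - a j" by force
        with x j show "x \<in> {a i..b i} \<times> V S i"
          by (force simp: V_def R_def)
      qed
      have "emeasure lborel (R i \<inter> ?E) \<le> emeasure lborel ({a i..b i} \<times> V S i)"
        by (intro emeasure_mono sub) (auto simp flip: borel_prod)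
      also have "\<dots> = ennreal (b i - a i) * emeasure lborel (V S i)"
        using i by (simp add: lborel_prod[symmetric] lborel.emeasure_pair_measure_Times)
      finally have *: "2 * emeasure lborel (R i \<inter> ?E) \<le> ennreal (b i - a i) * (2 * emeasure lborel (V S i))"
        using mult_left_mono[of _ _ "2::ennreal"] by (fastforce simp: mult_ac)
      also have "\<dots> \<le> ennreal (b i - a i) * ennreal (d i - c i)"
        using False by (intro mult_left_mono) auto
      also have "\<dots> = ennreal ((b i - a i) * (d i - c i))" (is "_ = ?A")
        using i by (simp add: ennreal_mult)
      finally have half: "2 * emeasure lborel (R i \<inter> ?E) \<le> ?A" .
      have eA: "?A = emeasure lborel (R i)" using i by (simp add: R_def emeasure_rectangle)
      have split: "?A = emeasure lborel (R i \<inter> ?E) + emeasure lborel (R i - ?E)"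
        unfolding eA using fin by (subst plus_emeasure) (auto simp: Int_Diff_Un intro!: sets.Diff)
      have "?A + ?A = 2 * ?A" by (simp add: mult_2)
      also have "\<dots> = 2 * emeasure lborel (R i \<inter> ?E) + 2 * emeasure lborel (R i - ?E)"
        by (simp add: split distrib_left)
      also have "\<dots> \<le> ?A + 2 * emeasure lborel (R i - ?E)"
        by (intro add_right_mono half)
      finally have Ale: "?A \<le> 2 * emeasure lborel (R i - ?E)"
        by (subst (asm) ennreal_add_left_cancel_le) auto
      have "(\<Sum>i\<in>insert i S. ennreal ((b i - a i) * (d i - c i))) \<le> 2 * emeasure lborel (R i - ?E) + 2 * emeasure lborel ?E"
        using fin \<open>i \<notin> S\<close> S Ale by (auto intro!: add_mono)
      also have "\<dots> = 2 * emeasure lborel ((R i - ?E) \<union> ?E)"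
        unfolding distrib_left[symmetric] using fin
        by (subst plus_emeasure) (auto intro!: sets.Diff)
      also have "(R i - ?E) \<union> ?E = (\<Union>i\<in>insert i S. R i)" by auto
      finally have 1: "(\<Sum>i\<in>insert i S. ennreal ((b i - a i) * (d i - c i))) \<le> 2 * emeasure lborel (\<Union>i\<in>insert i S. R i)" .
      have 2: "ennreal (d k - c k) \<le> 2 * emeasure lborel (V (insert i S) k)" if "k \<in> F" for k
        using S(3) that fin by (meson V_mono finite_insert mult_left_mono order_trans subset_insertI zero_le)
      have "V (insert i S) i = {c i..d i}" using i by (auto simp: V_def R_def)
      then have "emeasure lborel (V (insert i S) i) = ennreal (d i - c i)" using i by simp
      then have 3: "ennreal (d i - c i) \<le> 2 * emeasure lborel (V (insert i S) i)"
        by (simp add: mult_2)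
      show ?thesis using 1 2 3 S by (intro exI[of _ "insert i S"]) auto
    qed
  qed
  then show thesis using that by (auto simp: V_def)
qed

text \<open>The intervals start at \<open>a\<close>, \<open>a + l\<close>, \<open>a + 2 * l\<close>
  and so on; the minimum with \<open>b - l\<close> pushes those that would overrun back into
  \<open>{a..b}\<close>.\<close>

lemma square_cover_interval:
  fixes a b l x :: real
  assumes "0 < l" "l \<le> b - a" "a \<le> x" "x \<le> b"
  shows "\<exists>n\<le>nat \<lfloor>(b - a) / l\<rfloor>. x \<in> {min (a + n * l) (b - l)..min (a + n * l) (b - l) + l}"
proof -
  define n where "n = nat \<lfloor>(x - a) / l\<rfloor>"
  have "0 \<le> \<lfloor>(x - a) / l\<rfloor>" using assms by simp
  then have n: "real n = of_int \<lfloor>(x - a) / l\<rfloor>" by (simp add: n_def)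
  then have "real n \<le> (x - a) / l" "(x - a) / l < real n + 1" by linarith+
  then have 1: "real n * l \<le> x - a" "x - a < (real n + 1) * l"
    using assms by (simp_all add: field_simps)
  have "n \<le> nat \<lfloor>(b - a) / l\<rfloor>"
    unfolding n_def using assms by (intro nat_mono floor_mono divide_right_mono) auto
  with 1 assms show ?thesis by (intro exI[of _ n]) (auto simp: algebra_simps min_def)
qed

text \<open>A selected rectangle that meets \<open>R i\<close> and is at least as wide spans, once
  tripled horizontally, all of \<open>{a i..b i}\<close>. So the squares of side
  \<open>d i - c i\<close> that make up \<open>R i\<close> are half covered by the union
  \<open>E\<close> of the tripled selected rectangles, and \<open>square_covering\<close> applies.
  The constant is 18 from there times 2 from \<open>rectangle_selection\<close>.\<close>

lemma flat_family:
  fixes a b c d :: "'i \<Rightarrow> real" and w U :: "plane \<Rightarrow> ennreal"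
  assumes F: "finite F" "\<And>i. i \<in> F \<Longrightarrow> a i < b i" "\<And>i. i \<in> F \<Longrightarrow> c i < d i"
    and flat: "\<And>i. i \<in> F \<Longrightarrow> d i - c i \<le> b i - a i"
    and [measurable]: "w \<in> borel_measurable borel" "U \<in> borel_measurable borel"
    and sq: "\<And>a b l x. 0 < l \<Longrightarrow> x \<in> {a..a+l} \<times> {b..b+l} \<Longrightarrow>
      (\<integral>\<^sup>+y\<in>{a..a+l} \<times> {b..b+l}. w y \<partial>lborel) \<le> ennreal (l^2) * U x"
    and avg: "\<And>i. i \<in> F \<Longrightarrow> (\<integral>\<^sup>+y\<in>{2 * a i - b i..2 * b i - a i} \<times> {2 * c i - d i..2 * d i - c i}. U y \<partial>lborel)
      \<le> K * ennreal ((b i - a i) * (d i - c i))"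
  shows "(\<integral>\<^sup>+y\<in>(\<Union>i\<in>F. {a i..b i} \<times> {c i..d i}). w y \<partial>lborel)
    \<le> 36 * K * emeasure lborel (\<Union>i\<in>F. {a i..b i} \<times> {c i..d i})"
proof -
  define R where "R i = {a i..b i} \<times> {c i..d i}" for i
  have [measurable]: "R i \<in> sets borel" for i by (simp add: R_def)
  obtain S where S: "S \<subseteq> F"
    "(\<Sum>i\<in>S. ennreal ((b i - a i) * (d i - c i))) \<le> 2 * emeasure lborel (\<Union>i\<in>S. R i)"
    and half: "\<And>i. i \<in> F \<Longrightarrow> ennreal (d i - c i) \<le> 2 * emeasure lborel
      ({c i..d i} \<inter> (\<Union>j\<in>{j\<in>S. b i - a i \<le> b j - a j \<and> R i \<inter> R j \<noteq> {}}. {c j..d j}))"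
    using rectangle_selection[of F a b c d] F unfolding R_def by blast
  have fin: "finite S" using S F finite_subset by blast
  define T where "T i = {2 * a i - b i..2 * b i - a i} \<times> {c i..d i}" for i
  define E where "E = (\<Union>i\<in>S. T i)"
  have [measurable]: "T i \<in> sets borel" for i by (simp add: T_def)
  have E[measurable]: "E \<in> sets borel" unfolding E_def using fin by auto
  define l where "l i = d i - c i" for i
  define N where "N i = nat \<lfloor>(b i - a i) / l i\<rfloor>" for i
  \<comment> \<open>A pair \<open>(i, n)\<close> stands for the square number \<open>n\<close> along
    \<open>R i\<close>, placed as in \<open>square_cover_interval\<close>.\<close>
  define G where "G = (SIGMA i:F. {..N i})"
  define p where "p = (\<lambda>(i, n::nat). min (a i + n * l i) (b i - l i))"
  define Q where "Q k = {p k..p k + l (fst k)} \<times> {c (fst k)..c (fst k) + l (fst k)}" for k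
  have cover: "(\<Union>i\<in>F. R i) \<subseteq> (\<Union>k\<in>G. Q k)"
  proof
    fix x assume "x \<in> (\<Union>i\<in>F. R i)"
    then obtain i where i: "i \<in> F" "x \<in> R i" by blast
    have "\<exists>n\<le>nat \<lfloor>(b i - a i) / l i\<rfloor>. fst x \<in> {min (a i + n * l i) (b i - l i)..min (a i + n * l i) (b i - l i) + l i}"
      using i F flat by (intro square_cover_interval) (auto simp: R_def l_def)
    then obtain n where "n \<le> N i" "fst x \<in> {p (i, n)..p (i, n) + l i}" by (auto simp: N_def p_def)
    with i show "x \<in> (\<Union>k\<in>G. Q k)"
      by (intro UN_I[of "(i, n)"]) (auto simp: G_def Q_def R_def l_def)
  qed
  have 1: "(\<integral>\<^sup>+y\<in>(\<Union>k\<in>G. Q k). w y \<partial>lborel) \<le> 18 * (\<integral>\<^sup>+y\<in>E. U y \<partial>lborel)"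
    unfolding Q_def
  proof (rule square_covering[where l = "\<lambda>k. l (fst k)" and q = "\<lambda>k. c (fst k)"])
    show "finite G" using F by (auto simp: G_def)
    show "0 < l (fst k)" if "k \<in> G" for k using that F by (auto simp: G_def l_def)
    fix k assume k: "k \<in> G"
    obtain i n where kin: "k = (i, n)" by (cases k)
    have i: "i \<in> F" "a i < b i" "c i < d i" "l i \<le> b i - a i" using k kin F flat by (auto simp: G_def l_def)
    define V where "V = {c i..d i} \<inter> (\<Union>j\<in>{j\<in>S. b i - a i \<le> b j - a j \<and> R i \<inter> R j \<noteq> {}}. {c j..d j})"
    have [measurable]: "V \<in> sets borel" unfolding V_def using fin by auto
    have p: "a i \<le> p k" "p k + l i \<le> b i" using i by (auto simp: p_def kin l_def)
    have "ennreal ((l (fst k))\<^sup>2) = ennreal (l i) * ennreal (d i - c i)"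
      using i by (simp add: kin power2_eq_square ennreal_mult l_def)
    also have "\<dots> \<le> ennreal (l i) * (2 * emeasure lborel V)"
      unfolding V_def by (intro mult_left_mono half i) auto
    also have "\<dots> = 2 * emeasure lborel ({p k..p k + l i} \<times> V)"
      using i by (simp add: lborel_prod[symmetric] lborel.emeasure_pair_measure_Times l_def mult_ac)
    also have "\<dots> \<le> 2 * emeasure lborel (({p k..p k + l (fst k)} \<times> {c (fst k)..c (fst k) + l (fst k)}) \<inter> E)"
    proof (intro mult_left_mono emeasure_mono)
      show "{p k..p k + l i} \<times> V \<subseteq> ({p k..p k + l (fst k)} \<times> {c (fst k)..c (fst k) + l (fst k)}) \<inter> E"
        using p by (fastforce simp: kin V_def E_def T_def R_def l_def)
    qed auto
    finally show "ennreal ((l (fst k))\<^sup>2) \<le> \<dots>" .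
  qed (use sq in auto)
  have "(\<integral>\<^sup>+y\<in>E. U y \<partial>lborel) \<le> (\<Sum>i\<in>S. \<integral>\<^sup>+y\<in>T i. U y \<partial>lborel)"
    unfolding E_def using fin by (intro nn_integral_UN_le) auto
  also have "\<dots> \<le> (\<Sum>i\<in>S. K * ennreal ((b i - a i) * (d i - c i)))"
  proof (intro sum_mono)
    fix i assume "i \<in> S"
    then have i: "i \<in> F" using S by blast
    \<comment> \<open>\<open>T i\<close> is tripled in the first direction only. The rectangles of
      \<open>avg\<close> are tripled in both, which keeps the hypothesis symmetric under exchange of
      the coordinates.\<close>
    have "(\<integral>\<^sup>+y\<in>T i. U y \<partial>lborel) \<le> (\<integral>\<^sup>+y\<in>{2 * a i - b i..2 * b i - a i} \<times> {2 * c i - d i..2 * d i - c i}. U y \<partial>lborel)"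
      using F(3)[OF i] by (intro nn_set_integral_set_mono) (auto simp: T_def)
    also note avg[OF i]
    finally show "(\<integral>\<^sup>+y\<in>T i. U y \<partial>lborel) \<le> K * ennreal ((b i - a i) * (d i - c i))" .
  qed
  also have "\<dots> \<le> K * (2 * emeasure lborel (\<Union>i\<in>S. R i))"
    unfolding sum_distrib_left[symmetric] by (intro mult_left_mono S) auto
  also have "\<dots> \<le> K * (2 * emeasure lborel (\<Union>i\<in>F. R i))"
    using S F by (intro mult_left_mono emeasure_mono) auto
  finally have 2: "(\<integral>\<^sup>+y\<in>E. U y \<partial>lborel) \<le> K * (2 * emeasure lborel (\<Union>i\<in>F. R i))" .
  have "(\<integral>\<^sup>+y\<in>(\<Union>k\<in>G. Q k). w y \<partial>lborel) \<le> 18 * (K * (2 * emeasure lborel (\<Union>i\<in>F. R i)))"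
    by (intro order_trans[OF 1] mult_left_mono 2) auto
  also have "\<dots> = 36 * K * emeasure lborel (\<Union>i\<in>F. R i)" by (simp add: mult_ac)
  finally have "(\<integral>\<^sup>+y\<in>(\<Union>k\<in>G. Q k). w y \<partial>lborel) \<le> 36 * K * emeasure lborel (\<Union>i\<in>F. R i)" .
  moreover have "(\<integral>\<^sup>+y\<in>(\<Union>i\<in>F. R i). w y \<partial>lborel) \<le> (\<integral>\<^sup>+y\<in>(\<Union>k\<in>G. Q k). w y \<partial>lborel)"
    by (intro nn_set_integral_set_mono cover)
  ultimately show ?thesis by (auto simp: R_def)
qed

section \<open>Rectangles of both orientations, by exchange of the coordinates\<close>

lemma lborel_plane_swap: "distr lborel lborel prod.swap = (lborel :: plane measure)"
  using lborel_pair.distr_pair_swap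
  by (metis (no_types, lifting) case_prod_beta' ext lborel_prod prod.swap_def)

lemma nn_integral_plane_swap:
  fixes f :: "plane \<Rightarrow> ennreal"
  assumes [measurable]: "f \<in> borel_measurable borel"
  shows "(\<integral>\<^sup>+x. f (prod.swap x) \<partial>lborel) = (\<integral>\<^sup>+x. f x \<partial>lborel)"
proof -
  have "(\<integral>\<^sup>+x. f x \<partial>lborel) = (\<integral>\<^sup>+x. f x \<partial>distr lborel lborel prod.swap)"
    by (simp add: lborel_plane_swap)
  also have "\<dots> = (\<integral>\<^sup>+x. f (prod.swap x) \<partial>lborel)"
    by (subst nn_integral_distr) (auto intro!: borel_measurable_continuous_onI continuous_on_swap)
  finally show ?thesis by simp
qed

text \<open>\<open>H\<close> collects the rectangles at least as wide as high. For the others,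
  \<open>flat_family\<close> is applied to \<open>w\<close> and \<open>U\<close> composed with
  \<open>prod.swap\<close>. The constants 36 of the two halves add up.\<close>

lemma rectangle_family:
  fixes a b c d :: "'i \<Rightarrow> real" and w U :: "plane \<Rightarrow> ennreal"
  assumes F: "finite F" "\<And>i. i \<in> F \<Longrightarrow> a i < b i" "\<And>i. i \<in> F \<Longrightarrow> c i < d i"
    and [measurable]: "w \<in> borel_measurable borel" "U \<in> borel_measurable borel"
    and sq: "\<And>a b l x. 0 < l \<Longrightarrow> x \<in> {a..a+l} \<times> {b..b+l} \<Longrightarrow>
      (\<integral>\<^sup>+y\<in>{a..a+l} \<times> {b..b+l}. w y \<partial>lborel) \<le> ennreal (l^2) * U x"
    and avg: "\<And>i. i \<in> F \<Longrightarrow> (\<integral>\<^sup>+y\<in>{2 * a i - b i..2 * b i - a i} \<times> {2 * c i - d i..2 * d i - c i}. U y \<partial>lborel)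
      \<le> K * ennreal ((b i - a i) * (d i - c i))"
  shows "(\<integral>\<^sup>+y\<in>(\<Union>i\<in>F. {a i..b i} \<times> {c i..d i}). w y \<partial>lborel)
    \<le> 72 * K * emeasure lborel (\<Union>i\<in>F. {a i..b i} \<times> {c i..d i})"
proof -
  define R where "R i = {a i..b i} \<times> {c i..d i}" for i
  have [measurable]: "R i \<in> sets borel" for i by (simp add: R_def)
  have set_swap: "(\<integral>\<^sup>+y\<in>A \<times> B. f (prod.swap y) \<partial>lborel) = (\<integral>\<^sup>+y\<in>B \<times> A. f y \<partial>lborel)"
    if [measurable]: "f \<in> borel_measurable borel" "A \<in> sets borel" "B \<in> sets borel"
    for f :: "plane \<Rightarrow> ennreal" and A B
  proof -
    have "B \<times> A \<in> sets borel" by (auto simp flip: borel_prod)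
    then have "(\<lambda>y. f y * indicator (B \<times> A) y) \<in> borel_measurable borel" by measurable
    from nn_integral_plane_swap[OF this] show ?thesis
      by (simp add: indicator_def mem_Times_iff conj_commute)
  qed
  have swap[measurable]: "prod.swap \<in> borel_measurable (borel :: plane measure)"
    by (intro borel_measurable_continuous_onI continuous_on_swap)
  define H where "H = {i\<in>F. d i - c i \<le> b i - a i}"
  have "finite H" "finite (F - H)" using F by (auto simp: H_def)
  have sw: "(\<lambda>x. f (prod.swap x)) \<in> borel_measurable borel" if "f \<in> borel_measurable borel" for f :: "plane \<Rightarrow> ennreal"
    using swap that by measurable
  have H: "(\<integral>\<^sup>+y\<in>(\<Union>i\<in>H. R i). w y \<partial>lborel) \<le> 36 * K * emeasure lborel (\<Union>i\<in>H. R i)"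
    unfolding R_def using F sq avg \<open>finite H\<close> by (intro flat_family[where U = U]) (auto simp: H_def)
  have ind: "indicator (\<Union>i\<in>F-H. R i) (prod.swap y) = (indicator (\<Union>i\<in>F-H. {c i..d i} \<times> {a i..b i}) y :: ennreal)" for y
    by (cases y) (auto simp: R_def indicator_def)
  have "(\<integral>\<^sup>+y\<in>(\<Union>i\<in>F-H. {c i..d i} \<times> {a i..b i}). w (prod.swap y) \<partial>lborel)
      \<le> 36 * K * emeasure lborel (\<Union>i\<in>F-H. {c i..d i} \<times> {a i..b i})"
  proof (rule flat_family[where U = "\<lambda>x. U (prod.swap x)"])
    fix i assume "i \<in> F - H"
    then show "(\<integral>\<^sup>+y\<in>{2 * c i - d i..2 * d i - c i} \<times> {2 * a i - b i..2 * b i - a i}. U (prod.swap y) \<partial>lborel)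
      \<le> K * ennreal ((d i - c i) * (b i - a i))"
      using avg[of i] by (subst set_swap) (auto simp: mult_ac)
  next
    fix a b l :: real and x assume "0 < l" "x \<in> {a..a + l} \<times> {b..b + l}"
    then show "(\<integral>\<^sup>+y\<in>{a..a + l} \<times> {b..b + l}. w (prod.swap y) \<partial>lborel) \<le> ennreal (l\<^sup>2) * U (prod.swap x)"
      using sq[of l "prod.swap x" b a] by (subst set_swap) auto
  qed (use F sw in \<open>auto simp: H_def\<close>)
  also have "(\<integral>\<^sup>+y\<in>(\<Union>i\<in>F-H. {c i..d i} \<times> {a i..b i}). w (prod.swap y) \<partial>lborel) = (\<integral>\<^sup>+y\<in>(\<Union>i\<in>F-H. R i). w y \<partial>lborel)"
  proof -
    have "(\<Union>i\<in>F-H. R i) \<in> sets borel" using \<open>finite (F - H)\<close> by auto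
    then have "(\<lambda>y. w y * indicator (\<Union>i\<in>F-H. R i) y) \<in> borel_measurable borel" by measurable
    from nn_integral_plane_swap[OF this] show ?thesis
      by (simp only: ind)
  qed
  also have "emeasure lborel (\<Union>i\<in>F-H. {c i..d i} \<times> {a i..b i}) = emeasure lborel (\<Union>i\<in>F-H. R i)"
  proof -
    have "(\<Union>i\<in>F-H. R i) \<in> sets borel" "(\<Union>i\<in>F-H. {c i..d i} \<times> {a i..b i}) \<in> sets borel"
      using \<open>finite (F - H)\<close> by auto
    moreover from this have "(\<lambda>y. indicator (\<Union>i\<in>F-H. R i) y :: ennreal) \<in> borel_measurable borel" by measurable
    ultimately show ?thesis
      using nn_integral_plane_swap[of "indicator (\<Union>i\<in>F-H. R i)"] by (simp add: ind)
  qed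
  finally have V: "(\<integral>\<^sup>+y\<in>(\<Union>i\<in>F-H. R i). w y \<partial>lborel) \<le> 36 * K * emeasure lborel (\<Union>i\<in>F-H. R i)" .
  have m: "emeasure lborel (\<Union>i\<in>H. R i) \<le> emeasure lborel (\<Union>i\<in>F. R i)"
      "emeasure lborel (\<Union>i\<in>F-H. R i) \<le> emeasure lborel (\<Union>i\<in>F. R i)"
    using F by (auto intro!: emeasure_mono simp: H_def)
  \<comment> \<open>The union is taken over the set of the two partial unions. If these coincide the
    set is a singleton, so the comparison with two summands below is an inequality.\<close>
  have "(\<integral>\<^sup>+y\<in>(\<Union>i\<in>F. R i). w y \<partial>lborel) = (\<integral>\<^sup>+y\<in>(\<Union>X\<in>{\<Union>i\<in>H. R i, \<Union>i\<in>F-H. R i}. X). w y \<partial>lborel)"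
    by (auto simp: H_def intro!: nn_integral_cong arg_cong2[where f = "(*)"] arg_cong2[where f = indicator])
  also have "\<dots> \<le> (\<Sum>X\<in>{\<Union>i\<in>H. R i, \<Union>i\<in>F-H. R i}. \<integral>\<^sup>+y\<in>X. w y \<partial>lborel)"
    using \<open>finite H\<close> \<open>finite (F - H)\<close> by (intro nn_integral_UN_le) auto
  also have "\<dots> \<le> (\<integral>\<^sup>+y\<in>(\<Union>i\<in>H. R i). w y \<partial>lborel) + (\<integral>\<^sup>+y\<in>(\<Union>i\<in>F-H. R i). w y \<partial>lborel)"
    by (cases "(\<Union>i\<in>H. R i) = (\<Union>i\<in>F-H. R i)") auto
  also have "\<dots> \<le> 36 * K * emeasure lborel (\<Union>i\<in>F. R i) + 36 * K * emeasure lborel (\<Union>i\<in>F. R i)"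
    by (intro add_mono order_trans[OF H] order_trans[OF V] mult_left_mono m) auto
  also have "\<dots> = 72 * K * emeasure lborel (\<Union>i\<in>F. R i)"
    by (simp add: distrib_right[symmetric])
  finally show ?thesis by (simp add: R_def)
qed

section \<open>The unweighted estimate\<close>

text \<open>Where the average of \<open>h\<close> is at least \<open>s\<close>, the part of
  \<open>h\<close> below \<open>s / 2\<close> contributes at most half of \<open>s\<close> times the
  length, so \<open>h\<close> may be cut down to \<open>G\<close> at the price of a factor 2.
  Tripling the disjoint Vitali intervals costs the factor 3. The cut is what later limits the number
  of dyadic levels.\<close>

lemma interval_weak_type:
  fixes a b :: "'i \<Rightarrow> real" and h :: "real \<Rightarrow> ennreal"
  assumes F: "finite F" "\<And>i. i \<in> F \<Longrightarrow> a i < b i" and "0 < s"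
    and [measurable]: "h \<in> borel_measurable borel"
    and avg: "\<And>i. i \<in> F \<Longrightarrow> ennreal s * ennreal (b i - a i) \<le> (\<integral>\<^sup>+y\<in>{a i..b i}. h y \<partial>lborel)"
  shows "ennreal s * emeasure lborel (\<Union>i\<in>F. {a i..b i}) \<le> 6 * (\<integral>\<^sup>+y\<in>{y. ennreal (s / 2) < h y}. h y \<partial>lborel)"
proof -
  define G where "G = {y. ennreal (s / 2) < h y}"
  have [measurable]: "G \<in> sets borel" unfolding G_def by measurable
  obtain S where S: "S \<subseteq> F" "disjoint_family_on (\<lambda>i. {a i..b i}) S"
    "(\<Union>i\<in>F. {a i..b i}) \<subseteq> (\<Union>i\<in>S. {2 * a i - b i..2 * b i - a i})"
    using F by (elim finite_vitali[where r = "\<lambda>i. b i - a i" and X = "\<lambda>i. {a i..b i}"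
        and Y = "\<lambda>i. {2 * a i - b i..2 * b i - a i}"]) auto
  have fin: "finite S" using S F finite_subset by blast
  have *: "ennreal s * ennreal (b i - a i) \<le> 2 * (\<integral>\<^sup>+y\<in>{a i..b i}. h y * indicator G y \<partial>lborel)" if "i \<in> S" for i
  proof -
    have i: "i \<in> F" "a i < b i" using that S F by auto
    let ?L = "ennreal s * ennreal (b i - a i)"
    let ?J = "\<integral>\<^sup>+y\<in>{a i..b i}. h y * indicator G y \<partial>lborel"
    note avg[OF i(1)]
    also have "(\<integral>\<^sup>+y\<in>{a i..b i}. h y \<partial>lborel)
        \<le> (\<integral>\<^sup>+y. ennreal (s / 2) * indicator {a i..b i} y + h y * indicator G y * indicator {a i..b i} y \<partial>lborel)"
      by (intro nn_integral_mono) (auto simp: G_def indicator_def not_less)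
    also have "\<dots> = ennreal (s / 2) * ennreal (b i - a i) + ?J"
      using i by (subst nn_integral_add) (auto simp: nn_integral_cmult)
    finally have "2 * ?L \<le> 2 * (ennreal (s / 2) * ennreal (b i - a i) + ?J)"
      by (rule mult_left_mono) simp
    also have "\<dots> = ?L + 2 * ?J"
      using \<open>0 < s\<close> i by (simp add: distrib_left mult.assoc[symmetric] ennreal_mult''[symmetric]
          flip: ennreal_numeral)
    finally have "?L + ?L \<le> ?L + 2 * ?J" by (simp add: mult_2)
    then show ?thesis
      by (subst (asm) ennreal_add_left_cancel_le) (auto simp: ennreal_mult_eq_top_iff)
  qed
  have "emeasure lborel (\<Union>i\<in>F. {a i..b i}) \<le> emeasure lborel (\<Union>i\<in>S. {2 * a i - b i..2 * b i - a i})"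
    using S fin by (intro emeasure_mono) auto
  also have "\<dots> \<le> (\<Sum>i\<in>S. emeasure lborel {2 * a i - b i..2 * b i - a i})"
    using fin by (intro emeasure_subadditive_finite) auto
  also have "\<dots> = (\<Sum>i\<in>S. 3 * ennreal (b i - a i))"
  proof (intro sum.cong refl)
    fix i assume "i \<in> S"
    then have "a i < b i" using S F by auto
    then show "emeasure lborel {2 * a i - b i..2 * b i - a i} = 3 * ennreal (b i - a i)"
      by (simp add: ennreal_mult[symmetric] flip: ennreal_numeral)
  qed
  finally have "ennreal s * emeasure lborel (\<Union>i\<in>F. {a i..b i}) \<le> ennreal s * (\<Sum>i\<in>S. 3 * ennreal (b i - a i))"
    by (rule mult_left_mono) auto
  also have "\<dots> = 3 * (\<Sum>i\<in>S. ennreal s * ennreal (b i - a i))"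
    by (simp add: sum_distrib_left mult_ac)
  also have "\<dots> \<le> 3 * (\<Sum>i\<in>S. 2 * (\<integral>\<^sup>+y\<in>{a i..b i}. h y * indicator G y \<partial>lborel))"
    by (intro mult_left_mono sum_mono *) auto
  also have "\<dots> = 6 * (\<Sum>i\<in>S. (\<integral>\<^sup>+y\<in>{a i..b i}. h y * indicator G y \<partial>lborel))"
    by (simp add: sum_distrib_left[symmetric] mult.assoc[symmetric])
  also have "(\<Sum>i\<in>S. (\<integral>\<^sup>+y\<in>{a i..b i}. h y * indicator G y \<partial>lborel)) = (\<integral>\<^sup>+y\<in>(\<Union>i\<in>S. {a i..b i}). h y * indicator G y \<partial>lborel)"
    using fin S by (intro nn_integral_disjoint_UN) auto
  also have "\<dots> \<le> (\<integral>\<^sup>+y\<in>G. h y \<partial>lborel)"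
    by (intro nn_integral_mono) (auto simp: indicator_def)
  finally show ?thesis by (simp add: G_def mult_left_mono)
qed

section \<open>Dyadic layers and the two-dimensional estimate\<close>

lemma ennreal_le_suminf:
  fixes f :: "nat \<Rightarrow> ennreal"
  shows "f k \<le> suminf f"
  using sum_le_suminf[of f "{k}"] by simp

text \<open>For finite \<open>v\<close> above 1/2 one layer suffices: with the least
  \<open>k\<close> such that \<open>v \<le> 2 ^ k\<close>, the level \<open>2 ^ k / 2\<close> is
  below \<open>v\<close>. For infinite \<open>v\<close> all layers are present, and the sum exceeds
  every power of 2.\<close>

lemma ennreal_le_dyadic_layers:
  "v * indicator {v. ennreal (1/2) < v} v \<le> (\<Sum>k. ennreal (2 ^ k) * indicator {v. ennreal (2 ^ k / 2) < v} v)"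
    (is "_ \<le> suminf ?t")
proof -
  have t: "?t k \<le> suminf ?t" for k
    by (rule ennreal_le_suminf)
  show ?thesis
  proof (cases v)
    case (real r)
    show ?thesis
    proof (cases "1/2 < r")
      case True
      obtain n where "r < 2 ^ n" using real_arch_pow[of 2 r] by auto
      then have n: "r \<le> 2 ^ n" by simp
      define k where "k = (LEAST k. r \<le> 2 ^ k)"
      have k: "r \<le> 2 ^ k" unfolding k_def by (rule LeastI[of _ n]) fact
      \<comment> \<open>For \<open>k = 0\<close> this is the assumption \<open>1/2 < r\<close>; for
        a successor it is the minimality of \<open>k\<close>.\<close>
      have "2 ^ k / 2 < r"
      proof (cases k)
        case (Suc j)
        then have "\<not> r \<le> 2 ^ j" using not_less_Least[of j "\<lambda>k. r \<le> 2 ^ k"] by (simp add: k_def)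
        then show ?thesis using Suc by simp
      qed (use True in simp)
      then have "ennreal r \<le> ?t k" using k real by (auto intro!: ennreal_leI simp: ennreal_less_iff)
      also note t
      finally show ?thesis using real by (simp add: indicator_def)
    next
      case False
      then have "ennreal r \<le> ennreal (1 / 2)" by (intro ennreal_leI) auto
      then have "\<not> ennreal (1 / 2) < v" using real by (simp only: not_less)
      then show ?thesis by (simp only: indicator_def mem_Collect_eq if_False of_bool_def mult_zero_right zero_le)
    qed
  next
    case top
    have "ennreal (2 ^ k) \<le> suminf ?t" for k using t[of k] top by (simp add: less_top[symmetric])
    moreover have "\<exists>k. suminf ?t < ennreal (2 ^ k)" if fin: "suminf ?t \<noteq> top"
    proof -
      obtain r where r: "suminf ?t = ennreal r" "0 \<le> r" using fin by (cases "suminf ?t") auto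
      obtain n where "r < 2 ^ n" using real_arch_pow[of 2 r] by auto
      then show ?thesis using r by (auto simp: ennreal_less_iff)
    qed
    ultimately have "suminf ?t = top" using leD by blast
    then show "v * indicator {v. ennreal (1/2) < v} v \<le> suminf ?t" by (simp only: top_greatest)
  qed
qed

lemma set_nn_integral_times:
  fixes g :: "plane \<Rightarrow> ennreal"
  assumes [measurable]: "g \<in> borel_measurable borel" "A \<in> sets borel" "B \<in> sets borel"
  shows "(\<integral>\<^sup>+x\<in>A \<times> B. g x \<partial>lborel) = (\<integral>\<^sup>+y\<in>B. (\<integral>\<^sup>+u\<in>A. g (u, y) \<partial>lborel) \<partial>lborel)"
proof -
  have [measurable]: "A \<times> B \<in> sets borel" by (auto simp flip: borel_prod)
  have "(\<integral>\<^sup>+x\<in>A \<times> B. g x \<partial>lborel) = (\<integral>\<^sup>+y. (\<integral>\<^sup>+u. g (u, y) * indicator (A \<times> B) (u, y) \<partial>lborel) \<partial>lborel)"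
    by (subst lborel_pair.nn_integral_snd) (auto simp: lborel_prod)
  also have "\<dots> = (\<integral>\<^sup>+y. (\<integral>\<^sup>+u. g (u, y) * indicator A u * indicator B y \<partial>lborel) \<partial>lborel)"
    by (simp add: indicator_times mult_ac)
  also have "\<dots> = (\<integral>\<^sup>+y\<in>B. (\<integral>\<^sup>+u\<in>A. g (u, y) \<partial>lborel) \<partial>lborel)"
    by (intro nn_integral_cong nn_integral_multc) (measurable; simp)
  finally show ?thesis .
qed

text \<open>The one-dimensional weak-type estimate is applied twice: vertically to the horizontal maximal
  function \<open>h\<close>, then horizontally to \<open>g\<close>. The sum over \<open>k\<close> counts the dyadic levels below \<open>4 g\<close> and is the source of the
  logarithm.\<close>

lemma strong_weak_type_layers:
  fixes a b c d :: "'i \<Rightarrow> real" and g :: "plane \<Rightarrow> ennreal"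
  assumes F: "finite F" "\<And>i. i \<in> F \<Longrightarrow> a i < b i" "\<And>i. i \<in> F \<Longrightarrow> c i < d i"
    and [measurable]: "g \<in> borel_measurable borel"
    and avg: "\<And>i. i \<in> F \<Longrightarrow> ennreal ((b i - a i) * (d i - c i)) \<le> (\<integral>\<^sup>+x\<in>{a i..b i} \<times> {c i..d i}. g x \<partial>lborel)"
  shows "emeasure lborel (\<Union>i\<in>F. {a i..b i} \<times> {c i..d i})
    \<le> 72 * (\<integral>\<^sup>+x. g x * (\<Sum>k. indicator {x. ennreal (2 ^ k / 4) < g x} x) \<partial>lborel)"
proof -
  \<comment> \<open>\<open>m i y\<close> is the average of \<open>g\<close> over
    \<open>{a i..b i}\<close> at height \<open>y\<close>, where \<open>y\<close> is not confined to
    \<open>{c i..d i}\<close>. \<open>h\<close> is the largest of these averages over the intervals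
    that contain the first coordinate.\<close>
  define m where "m i y = ennreal (1 / (b i - a i)) * (\<integral>\<^sup>+u\<in>{a i..b i}. g (u, y) \<partial>lborel)" for i y
  define h where "h = (\<lambda>(x, y). SUP i\<in>F. indicator {a i..b i} x * m i y)"
  have g2[measurable]: "(\<lambda>x. g (fst x, snd x)) \<in> borel_measurable (borel \<Otimes>\<^sub>M borel)"
    by (simp add: borel_prod)
  have [measurable]: "(\<lambda>u. g (u, y)) \<in> borel_measurable borel" for y by measurable
  have m[measurable]: "m i \<in> borel_measurable borel" for i
  proof -
    have "case_prod (\<lambda>y u. g (u, y) * indicator {a i..b i} u) \<in> borel_measurable (borel \<Otimes>\<^sub>M lborel)"
      by measurable
    from lborel.borel_measurable_nn_integral[OF this] show ?thesis unfolding m_def by measurable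
  qed
  have h[measurable]: "h \<in> borel_measurable (borel \<Otimes>\<^sub>M borel)"
    unfolding h_def using countable_finite[OF F(1)] by measurable
  have h'[measurable]: "h \<in> borel_measurable borel" using h by (simp add: borel_prod)
  let ?\<Omega> = "\<Union>i\<in>F. {a i..b i} \<times> {c i..d i}"
  have [measurable]: "?\<Omega> \<in> sets borel" using F by auto
  \<comment> \<open>On the vertical line through \<open>x\<close>, for each rectangle that this line
    meets, the average of \<open>h\<close> over \<open>{c i..d i}\<close> is at least the average of
    \<open>g\<close> over the rectangle, hence at least 1.\<close>
  have slice: "emeasure lborel {y. (x, y) \<in> ?\<Omega>} \<le> 6 * (\<integral>\<^sup>+y\<in>{y. ennreal (1 / 2) < h (x, y)}. h (x, y) \<partial>lborel)" for x
  proof -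
    let ?H = "{i\<in>F. x \<in> {a i..b i}}"
    have "ennreal 1 * emeasure lborel (\<Union>i\<in>?H. {c i..d i}) \<le> 6 * (\<integral>\<^sup>+y\<in>{y. ennreal (1 / 2) < h (x, y)}. h (x, y) \<partial>lborel)"
    proof (intro interval_weak_type)
      fix i assume i: "i \<in> ?H"
      then have ab: "a i < b i" "c i < d i" using F by auto
      have "ennreal 1 * ennreal (d i - c i) = ennreal (1 / (b i - a i)) * ennreal ((b i - a i) * (d i - c i))"
        using ab by (subst ennreal_mult''[symmetric]) auto
      also have "\<dots> \<le> ennreal (1 / (b i - a i)) * (\<integral>\<^sup>+x\<in>{a i..b i} \<times> {c i..d i}. g x \<partial>lborel)"
        using i by (intro mult_left_mono avg) auto
      also have "\<dots> = ennreal (1 / (b i - a i)) * (\<integral>\<^sup>+y\<in>{c i..d i}. (\<integral>\<^sup>+u\<in>{a i..b i}. g (u, y) \<partial>lborel) \<partial>lborel)"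
        by (subst set_nn_integral_times) auto
      also have "\<dots> = (\<integral>\<^sup>+y\<in>{c i..d i}. m i y \<partial>lborel)"
      proof -
        have "case_prod (\<lambda>y u. g (u, y) * indicator {a i..b i} u) \<in> borel_measurable (borel \<Otimes>\<^sub>M lborel)"
          by measurable
        from lborel.borel_measurable_nn_integral[OF this] show ?thesis
          by (subst nn_integral_cmult[symmetric]) (auto simp: m_def mult_ac)
      qed
      also have "\<dots> \<le> (\<integral>\<^sup>+y\<in>{c i..d i}. h (x, y) \<partial>lborel)"
        using i by (intro nn_integral_mono mult_right_mono) (auto simp: h_def intro!: SUP_upper2[of i])
      finally show "ennreal 1 * ennreal (d i - c i) \<le> (\<integral>\<^sup>+y\<in>{c i..d i}. h (x, y) \<partial>lborel)" .
    qed (use F in auto)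
    also have "(\<Union>i\<in>?H. {c i..d i}) = {y. (x, y) \<in> ?\<Omega>}" by auto
    finally show ?thesis by simp
  qed
  \<comment> \<open>On a horizontal line the superlevel set of \<open>h\<close> is the union of the
    intervals on which \<open>g\<close> has average above the level. The estimate at level
    \<open>2 ^ k / 2\<close> cuts \<open>g\<close> at \<open>2 ^ k / 4\<close>; doubling it turns 6
    into 12.\<close>
  have layer: "ennreal (2 ^ k) * emeasure lborel {x. ennreal (2 ^ k / 2) < h (x, y)}
      \<le> 12 * (\<integral>\<^sup>+x\<in>{x. ennreal (2 ^ k / 4) < g (x, y)}. g (x, y) \<partial>lborel)" for k y
  proof -
    let ?H = "{i\<in>F. ennreal (2 ^ k / 2) < m i y}"
    have "ennreal (2 ^ k / 2) * emeasure lborel (\<Union>i\<in>?H. {a i..b i})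
        \<le> 6 * (\<integral>\<^sup>+x\<in>{x. ennreal (2 ^ k / 2 / 2) < g (x, y)}. g (x, y) \<partial>lborel)"
    proof (intro interval_weak_type)
      fix i assume i: "i \<in> ?H"
      then have ab: "a i < b i" using F by auto
      have "ennreal (2 ^ k / 2) * ennreal (b i - a i) \<le> m i y * ennreal (b i - a i)"
        using i by (intro mult_right_mono) auto
      also have "\<dots> = (ennreal (1 / (b i - a i)) * ennreal (b i - a i)) * (\<integral>\<^sup>+u\<in>{a i..b i}. g (u, y) \<partial>lborel)"
        by (simp add: m_def mult_ac)
      also have "ennreal (1 / (b i - a i)) * ennreal (b i - a i) = 1"
        using ab by (subst ennreal_mult''[symmetric]) auto
      finally show "ennreal (2 ^ k / 2) * ennreal (b i - a i) \<le> (\<integral>\<^sup>+x\<in>{a i..b i}. g (x, y) \<partial>lborel)"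
        by simp
    qed (use F in auto)
    also have "(\<Union>i\<in>?H. {a i..b i}) = {x. ennreal (2 ^ k / 2) < h (x, y)}"
      by (auto simp: h_def less_SUP_iff indicator_def split: if_splits)
    finally have "2 * (ennreal (2 ^ k / 2) * emeasure lborel {x. ennreal (2 ^ k / 2) < h (x, y)})
      \<le> 2 * (6 * (\<integral>\<^sup>+x\<in>{x. ennreal (2 ^ k / 4) < g (x, y)}. g (x, y) \<partial>lborel))"
      by (intro mult_left_mono) auto
    moreover have "2 * ennreal (2 ^ k / 2) = ennreal (2 ^ k)"
      by (simp add: ennreal_mult''[symmetric] flip: ennreal_numeral)
    ultimately show ?thesis by (simp add: mult.assoc[symmetric])
  qed
  have "emeasure lborel ?\<Omega> = (\<integral>\<^sup>+x. emeasure lborel {y. (x, y) \<in> ?\<Omega>} \<partial>lborel)"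
  proof -
    have "?\<Omega> \<in> sets (lborel \<Otimes>\<^sub>M lborel)" unfolding lborel_prod by simp
    from lborel.emeasure_pair_measure_alt[OF this] show ?thesis by (simp only: lborel_prod vimage_def)
  qed
  also have "\<dots> \<le> (\<integral>\<^sup>+x. 6 * (\<integral>\<^sup>+y\<in>{y. ennreal (1 / 2) < h (x, y)}. h (x, y) \<partial>lborel) \<partial>lborel)"
    by (intro nn_integral_mono slice)
  also have "\<dots> = 6 * (\<integral>\<^sup>+x. (\<integral>\<^sup>+y. h (x, y) * indicator {v. ennreal (1 / 2) < v} (h (x, y)) \<partial>lborel) \<partial>lborel)"
    by (subst nn_integral_cmult) (auto simp: indicator_def)
  \<comment> \<open>\<open>slice\<close> works on vertical lines and \<open>layer\<close> on
    horizontal ones, hence the change in the order of integration.\<close>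
  also have "\<dots> = 6 * (\<integral>\<^sup>+y. (\<integral>\<^sup>+x. h (x, y) * indicator {v. ennreal (1 / 2) < v} (h (x, y)) \<partial>lborel) \<partial>lborel)"
    by (subst lborel_pair.Fubini) auto
  also have "(\<integral>\<^sup>+y. (\<integral>\<^sup>+x. h (x, y) * indicator {v. ennreal (1 / 2) < v} (h (x, y)) \<partial>lborel) \<partial>lborel)
      \<le> (\<integral>\<^sup>+y. (\<integral>\<^sup>+x. (\<Sum>k. ennreal (2 ^ k) * indicator {v. ennreal (2 ^ k / 2) < v} (h (x, y))) \<partial>lborel) \<partial>lborel)"
    by (intro nn_integral_mono ennreal_le_dyadic_layers)
  also have "\<dots> = (\<integral>\<^sup>+y. (\<Sum>k. ennreal (2 ^ k) * emeasure lborel {x. ennreal (2 ^ k / 2) < h (x, y)}) \<partial>lborel)"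
  proof (intro nn_integral_cong)
    fix y
    have "(\<integral>\<^sup>+x. ennreal (2 ^ k) * indicator {v. ennreal (2 ^ k / 2) < v} (h (x, y)) \<partial>lborel)
        = ennreal (2 ^ k) * emeasure lborel {x. ennreal (2 ^ k / 2) < h (x, y)}" for k
      by (subst nn_integral_cmult_indicator[symmetric]) (auto simp: indicator_def)
    then show "(\<integral>\<^sup>+x. (\<Sum>k. ennreal (2 ^ k) * indicator {v. ennreal (2 ^ k / 2) < v} (h (x, y))) \<partial>lborel)
        = (\<Sum>k. ennreal (2 ^ k) * emeasure lborel {x. ennreal (2 ^ k / 2) < h (x, y)})"
      by (subst nn_integral_suminf) auto
  qed
  also have "\<dots> \<le> (\<integral>\<^sup>+y. (\<Sum>k. 12 * (\<integral>\<^sup>+x\<in>{x. ennreal (2 ^ k / 4) < g (x, y)}. g (x, y) \<partial>lborel)) \<partial>lborel)"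
    by (intro nn_integral_mono suminf_le layer) auto
  also have "\<dots> = (\<integral>\<^sup>+y. 12 * (\<integral>\<^sup>+x. g (x, y) * (\<Sum>k. indicator {x. ennreal (2 ^ k / 4) < g x} (x, y)) \<partial>lborel) \<partial>lborel)"
  proof (intro nn_integral_cong)
    fix y
    have "(\<Sum>k. 12 * (\<integral>\<^sup>+x\<in>{x. ennreal (2 ^ k / 4) < g (x, y)}. g (x, y) \<partial>lborel))
      = 12 * (\<integral>\<^sup>+x. (\<Sum>k. g (x, y) * indicator {x. ennreal (2 ^ k / 4) < g (x, y)} x) \<partial>lborel)"
      by (subst nn_integral_suminf) auto
    then show "(\<Sum>k. 12 * (\<integral>\<^sup>+x\<in>{x. ennreal (2 ^ k / 4) < g (x, y)}. g (x, y) \<partial>lborel))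
      = 12 * (\<integral>\<^sup>+x. g (x, y) * (\<Sum>k. indicator {x. ennreal (2 ^ k / 4) < g x} (x, y)) \<partial>lborel)"
      by (simp add: indicator_def)
  qed
  also have "\<dots> = 12 * (\<integral>\<^sup>+y. (\<integral>\<^sup>+x. g (x, y) * (\<Sum>k. indicator {x. ennreal (2 ^ k / 4) < g x} (x, y)) \<partial>lborel) \<partial>lborel)"
    by (subst nn_integral_cmult) (auto intro!: lborel.borel_measurable_nn_integral simp: case_prod_beta')
  also have "\<dots> = 12 * (\<integral>\<^sup>+x. g x * (\<Sum>k. indicator {x. ennreal (2 ^ k / 4) < g x} x) \<partial>lborel)"
    by (subst lborel_pair.nn_integral_snd) (auto simp: lborel_prod)
  finally show ?thesis by (simp add: mult_left_mono mult.assoc[symmetric])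
qed

text \<open>For \<open>r\<close> above 1/4, the \<open>k\<close> with \<open>2 ^ k < 4 * r\<close>
  number at most the ceiling of \<open>log 2 (4 * r)\<close>, hence at most
  \<open>3 + log_plus r / ln 2\<close>, and \<open>1 / ln 2 \<le> 3\<close>. For smaller
  \<open>r\<close> there are none.\<close>

lemma layer_count_le:
  fixes r :: real assumes "0 \<le> r"
  shows "ennreal r * (\<Sum>k. indicator {v. ennreal (2 ^ k / 4) < v} (ennreal r)) \<le> ennreal (3 * (r * (1 + log_plus r)))"
proof -
  define A where "A = {k::nat. 2 ^ k / 4 < r}"
  show ?thesis
  proof (cases "1/4 < r")
    case False
    then have "4 * r \<le> 2 ^ k" for k
      by (intro order_trans[OF _ one_le_power[of "2::real" k]]) auto
    then have "ennreal (2 ^ k / 4) < ennreal r \<longleftrightarrow> False" for k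
      using assms by (simp add: ennreal_less_iff not_less mult.commute)
    then show ?thesis by simp
  next
    case True
    have A: "A = {k. real k < log 2 (4 * r)}"
      using True by (auto simp: A_def less_log_iff powr_realpow field_simps)
    then have sub: "A \<subseteq> {..<nat \<lceil>log 2 (4 * r)\<rceil>}" by (auto simp: less_ceiling_iff zless_nat_eq_int_zless)
    then have fin: "finite A" using finite_subset by blast
    have "(\<Sum>k. indicator {v. ennreal (2 ^ k / 4) < v} (ennreal r)) = (\<Sum>k\<in>A. 1::ennreal)"
      using assms by (subst suminf_finite[OF fin]) (auto simp: A_def ennreal_less_iff indicator_def)
    also have "\<dots> = ennreal (real (card A))" by (simp add: ennreal_of_nat_eq_real_of_nat)
    also have "\<dots> \<le> ennreal (3 * (1 + log_plus r))"
    proof (rule ennreal_leI)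
      have "card A \<le> nat \<lceil>log 2 (4 * r)\<rceil>" using card_mono[OF _ sub] by simp
      \<comment> \<open>Replacing \<open>r\<close> by \<open>max 1 r\<close> keeps the logarithm
        nonnegative and produces \<open>log_plus\<close>.\<close>
      also have "\<dots> \<le> nat \<lceil>log 2 (4 * max 1 r)\<rceil>"
        using True by (intro nat_mono ceiling_mono log_mono) auto
      finally have "real (card A) \<le> real (nat \<lceil>log 2 (4 * max 1 r)\<rceil>)" by (rule of_nat_mono)
      also have "\<dots> \<le> log 2 (4 * max 1 r) + 1"
      proof -
        have "0 \<le> log 2 (4 * max 1 r)" by (subst zero_le_log_cancel_iff) auto
        then show ?thesis using of_int_ceiling_le_add_one[of "log 2 (4 * max 1 r)"] by simp
      qed
      also have "log 2 (4 * max 1 r) = 2 + ln (max 1 r) / ln 2"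
      proof -
        have "ln (4 * max 1 r) = ln (2 ^ 2) + ln (max 1 r)" by (subst ln_mult_pos[symmetric]) auto
        then show ?thesis by (subst (asm) ln_realpow) (simp_all add: log_def add_divide_distrib)
      qed
      also have "ln (max 1 r) = log_plus r" using True by (auto simp: log_plus_def max_def)
      also have "log_plus r / ln 2 \<le> 3 * log_plus r"
      proof -
        have "1 / 3 \<le> ln (2::real)" using ln2_ge_two_thirds by linarith
        moreover have "0 \<le> log_plus r" by (simp add: log_plus_def)
        ultimately show ?thesis
          using mult_left_mono[of 1 "3 * ln 2" "log_plus r"] by (simp add: field_simps)
      qed
      finally show "real (card A) \<le> 3 * (1 + log_plus r)" by simp
    qed
    finally have "ennreal r * (\<Sum>k. indicator {v. ennreal (2 ^ k / 4) < v} (ennreal r)) \<le> ennreal r * ennreal (3 * (1 + log_plus r))"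
      by (rule mult_left_mono) auto
    also have "\<dots> = ennreal (3 * (r * (1 + log_plus r)))"
      using assms by (subst ennreal_mult[symmetric]) (auto simp: log_plus_def algebra_simps)
    finally show ?thesis .
  qed
qed

lemma strong_weak_type:
  fixes a b c d :: "'i \<Rightarrow> real" and g :: "plane \<Rightarrow> real"
  assumes F: "finite F" "\<And>i. i \<in> F \<Longrightarrow> a i < b i" "\<And>i. i \<in> F \<Longrightarrow> c i < d i"
    and [measurable]: "g \<in> borel_measurable borel" and g: "\<And>x. 0 \<le> g x"
    and avg: "\<And>i. i \<in> F \<Longrightarrow> ennreal ((b i - a i) * (d i - c i)) \<le> (\<integral>\<^sup>+x\<in>{a i..b i} \<times> {c i..d i}. ennreal (g x) \<partial>lborel)"
  shows "emeasure lborel (\<Union>i\<in>F. {a i..b i} \<times> {c i..d i})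
    \<le> 216 * (\<integral>\<^sup>+x. ennreal (g x * (1 + log_plus (g x))) \<partial>lborel)"
proof -
  have [measurable]: "log_plus \<in> borel_measurable borel" unfolding log_plus_def by measurable
  have "emeasure lborel (\<Union>i\<in>F. {a i..b i} \<times> {c i..d i})
    \<le> 72 * (\<integral>\<^sup>+x. ennreal (g x) * (\<Sum>k. indicator {x. ennreal (2 ^ k / 4) < ennreal (g x)} x) \<partial>lborel)"
    using assms by (intro strong_weak_type_layers) auto
  also have "\<dots> \<le> 72 * (\<integral>\<^sup>+x. 3 * ennreal (g x * (1 + log_plus (g x))) \<partial>lborel)"
  proof (intro mult_left_mono nn_integral_mono)
    fix x
    show "ennreal (g x) * (\<Sum>k. indicator {x. ennreal (2 ^ k / 4) < ennreal (g x)} x) \<le> 3 * ennreal (g x * (1 + log_plus (g x)))"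
      using layer_count_le[OF g, of x] g[of x]
      by (simp add: indicator_def ennreal_mult'[of 3])
  qed auto
  also have "\<dots> = 216 * (\<integral>\<^sup>+x. ennreal (g x * (1 + log_plus (g x))) \<partial>lborel)"
    by (subst nn_integral_cmult) (auto simp: mult.assoc[symmetric])
  finally show ?thesis .
qed

section \<open>The weighted estimate for finite families\<close>

text \<open>Zero is included as the level of rectangles whose tripled copies carry no
  \<open>U\<close>-mass.\<close>

definition dyadic_powers :: "real set" where
  "dyadic_powers = insert 0 (range (\<lambda>k::int. 2 powr k))"

lemma dyadic_powers_gap:
  assumes "x \<in> dyadic_powers" "y \<in> dyadic_powers" "x < y"
  shows "2 * x \<le> y"
proof (cases "x = 0")
  case False
  then obtain j where j: "x = 2 powr real_of_int j" using assms by (auto simp: dyadic_powers_def)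
  moreover have "y \<noteq> 0" using assms j by (auto simp: not_less)
  ultimately obtain k where k: "y = 2 powr real_of_int k" using assms by (auto simp: dyadic_powers_def)
  have "j < k" using assms j k by simp
  then have "2 powr (1 + real_of_int j) \<le> 2 powr real_of_int k" by (intro powr_mono) auto
  then show ?thesis using j k by (simp add: powr_add)
qed (use assms in auto)

text \<open>A geometric series: by \<open>dyadic_powers_gap\<close> all elements below the largest
  one, \<open>y\<close>, are at most \<open>y / 2\<close>, so by induction they add up to at most
  \<open>y\<close>.\<close>

lemma sum_dyadic_powers_le:
  assumes "finite A" "A \<subseteq> dyadic_powers" "\<And>x. x \<in> A \<Longrightarrow> x \<le> M" "0 \<le> M"
  shows "\<Sum>A \<le> 2 * M"
  using assms
proof (induction A arbitrary: M rule: finite_linorder_max_induct)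
  case (insert y A)
  have y: "0 \<le> y" "y \<le> M" using insert.prems by (auto simp: dyadic_powers_def)
  have "\<Sum>A \<le> 2 * (y / 2)"
  proof (rule insert.IH)
    fix x assume "x \<in> A"
    then show "x \<le> y / 2" using insert dyadic_powers_gap[of x y] by auto
  qed (use insert y in auto)
  moreover have "y \<notin> A" using insert.hyps by blast
  ultimately show ?case using insert.hyps y by simp
qed auto

lemma dyadic_power_between:
  assumes "0 \<le> x"
  obtains y where "y \<in> dyadic_powers" "x \<le> y" "y \<le> 2 * x"
proof (cases "x = 0")
  case False
  define k where "k = \<lceil>log 2 x\<rceil>"
  have x: "x = 2 powr (log 2 x)" using assms False by simp
  have "x \<le> 2 powr k" by (subst x) (auto simp: k_def intro!: powr_mono)
  moreover have "2 powr k \<le> 2 powr (1 + log 2 x)" unfolding k_def by (intro powr_mono) linarith+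
  then have "2 powr k \<le> 2 * x" using assms False by (simp add: powr_add)
  ultimately show ?thesis by (intro that[of "2 powr k"]) (auto simp: dyadic_powers_def)
qed (auto simp: dyadic_powers_def intro: that[of 0])

text \<open>The constant is \<open>72 * 216 * 36\<close>: the first two factors come from
  \<open>rectangle_family\<close> and \<open>strong_weak_type\<close> within one group. The last is
  \<open>2 * 2 * 9\<close>, for the sum of dyadic levels, the rounding to a level, and the area of a
  tripled rectangle.\<close>

lemma finite_rectangle_estimate:
  fixes a b c d :: "'i \<Rightarrow> real" and w U W :: "plane \<Rightarrow> ennreal" and g :: "plane \<Rightarrow> real"
  assumes F: "finite F" "\<And>i. i \<in> F \<Longrightarrow> a i < b i" "\<And>i. i \<in> F \<Longrightarrow> c i < d i"
    and [measurable]: "w \<in> borel_measurable borel" "U \<in> borel_measurable borel"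
      "g \<in> borel_measurable borel" and g: "\<And>x. 0 \<le> g x"
    and sq: "\<And>a b l x. 0 < l \<Longrightarrow> x \<in> {a..a+l} \<times> {b..b+l} \<Longrightarrow>
      (\<integral>\<^sup>+y\<in>{a..a+l} \<times> {b..b+l}. w y \<partial>lborel) \<le> ennreal (l^2) * U x"
    and avg: "\<And>i. i \<in> F \<Longrightarrow> ennreal ((b i - a i) * (d i - c i)) \<le> (\<integral>\<^sup>+x\<in>{a i..b i} \<times> {c i..d i}. ennreal (g x) \<partial>lborel)"
    and W: "\<And>i x. i \<in> F \<Longrightarrow> x \<in> {a i..b i} \<times> {c i..d i} \<Longrightarrow>
      (\<integral>\<^sup>+y\<in>{2 * a i - b i..2 * b i - a i} \<times> {2 * c i - d i..2 * d i - c i}. U y \<partial>lborel)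
      \<le> 9 * ennreal ((b i - a i) * (d i - c i)) * W x"
  shows "(\<integral>\<^sup>+y\<in>(\<Union>i\<in>F. {a i..b i} \<times> {c i..d i}). w y \<partial>lborel)
    \<le> 559872 * (\<integral>\<^sup>+x. ennreal (g x * (1 + log_plus (g x))) * W x \<partial>lborel)"
proof -
  have [measurable]: "log_plus \<in> borel_measurable borel" unfolding log_plus_def by measurable
  have lp: "0 \<le> log_plus r" for r by (simp add: log_plus_def)
  define \<Phi> where "\<Phi> x = ennreal (g x * (1 + log_plus (g x)))" for x
  have \<Phi>[measurable]: "\<Phi> \<in> borel_measurable borel" unfolding \<Phi>_def by measurable
  have g_le: "ennreal (g x) \<le> \<Phi> x" for x
    unfolding \<Phi>_def using lp g by (intro ennreal_leI) (simp add: distrib_left)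
  define R where "R i = {a i..b i} \<times> {c i..d i}" for i
  have [measurable]: "R i \<in> sets borel" for i by (simp add: R_def)
  define \<rho> where "\<rho> i = (b i - a i) * (d i - c i)" for i
  have \<rho>: "0 < \<rho> i" if "i \<in> F" for i using F that by (simp add: \<rho>_def)
  define A where "A i = (\<integral>\<^sup>+y\<in>{2 * a i - b i..2 * b i - a i} \<times> {2 * c i - d i..2 * d i - c i}. U y \<partial>lborel)" for i
  have AW: "A i \<le> 9 * ennreal (\<rho> i) * W x" if "i \<in> F" "x \<in> R i" for i x
    using W that by (simp add: A_def \<rho>_def R_def)
  show ?thesis
  proof (cases "\<exists>i\<in>F. A i = top")
    case True
    then obtain i where i: "i \<in> F" "A i = top" by blast
    \<comment> \<open>\<open>W\<close> is infinite on \<open>R i\<close>, while \<open>avg\<close>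
      makes the integral of \<open>\<Phi>\<close> over \<open>R i\<close> positive; so the
      right-hand side is infinite.\<close>
    have W_top: "W x = top" if "x \<in> R i" for x
      using AW[OF i(1) that] i(2) by (simp add: top_unique ennreal_mult_eq_top_iff)
    have "0 < ennreal (\<rho> i)" using \<rho> i by simp
    also have "ennreal (\<rho> i) \<le> (\<integral>\<^sup>+x\<in>R i. ennreal (g x) \<partial>lborel)" using avg[OF i(1)] by (simp add: \<rho>_def R_def)
    also have "\<dots> \<le> (\<integral>\<^sup>+x\<in>R i. \<Phi> x \<partial>lborel)"
      by (intro nn_integral_mono mult_right_mono g_le) auto
    finally have "top = top * (\<integral>\<^sup>+x\<in>R i. \<Phi> x \<partial>lborel)"
      by (simp add: ennreal_top_mult)
    also have "\<dots> = (\<integral>\<^sup>+x. top * (\<Phi> x * indicator (R i) x) \<partial>lborel)"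
      by (subst nn_integral_cmult) auto
    also have "\<dots> \<le> (\<integral>\<^sup>+x. \<Phi> x * W x \<partial>lborel)"
      by (intro nn_integral_mono) (auto simp: indicator_def W_top mult.commute)
    finally have "(\<integral>\<^sup>+x. \<Phi> x * W x \<partial>lborel) = top" by (simp add: top_unique)
    then show ?thesis by (simp add: \<Phi>_def ennreal_mult_top)
  next
    case False
    \<comment> \<open>The ratio of \<open>A i\<close> to the area \<open>\<rho> i\<close> is rounded
      up to a dyadic level. The lower bound for the level serves \<open>fam\<close>, the upper one
      \<open>layers\<close>.\<close>
    have "\<exists>y\<in>dyadic_powers. A i \<le> ennreal (y * \<rho> i) \<and> ennreal (y * \<rho> i) \<le> 2 * A i" if i: "i \<in> F" for i
    proof -
      obtain \<alpha> where \<alpha>: "A i = ennreal \<alpha>" "0 \<le> \<alpha>" using False i by (cases "A i") auto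
      obtain y where y: "y \<in> dyadic_powers" "\<alpha> / \<rho> i \<le> y" "y \<le> 2 * (\<alpha> / \<rho> i)"
        using dyadic_power_between[of "\<alpha> / \<rho> i"] \<alpha> \<rho>[OF i] by (metis divide_nonneg_pos)
      then have "\<alpha> \<le> y * \<rho> i" "y * \<rho> i \<le> 2 * \<alpha>" using \<rho>[OF i] by (simp_all add: field_simps)
      then show ?thesis using y \<alpha>
        by (intro bexI[of _ y]) (auto intro!: ennreal_leI simp: ennreal_mult'[symmetric] simp flip: ennreal_numeral)
    qed
    then obtain L where L: "\<And>i. i \<in> F \<Longrightarrow> L i \<in> dyadic_powers"
        "\<And>i. i \<in> F \<Longrightarrow> A i \<le> ennreal (L i * \<rho> i)" "\<And>i. i \<in> F \<Longrightarrow> ennreal (L i * \<rho> i) \<le> 2 * A i"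
      by metis
    have dy_nonneg: "0 \<le> y" if "y \<in> dyadic_powers" for y using that by (auto simp: dyadic_powers_def)
    define H where "H y = {i\<in>F. L i = y}" for y
    define \<Omega> where "\<Omega> y = (\<Union>i\<in>H y. R i)" for y
    have finH: "finite (H y)" for y using F by (simp add: H_def)
    have [measurable]: "\<Omega> y \<in> sets borel" for y unfolding \<Omega>_def using finH by auto
    have fam: "(\<integral>\<^sup>+x\<in>\<Omega> y. w x \<partial>lborel) \<le> 15552 * (ennreal y * (\<integral>\<^sup>+x\<in>\<Omega> y. \<Phi> x \<partial>lborel))" if y: "y \<in> dyadic_powers" for y
    proof -
      have 1: "(\<integral>\<^sup>+x\<in>\<Omega> y. w x \<partial>lborel) \<le> 72 * ennreal y * emeasure lborel (\<Omega> y)"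
        unfolding \<Omega>_def R_def
      proof (rule rectangle_family[where U = U])
        fix i assume i: "i \<in> H y"
        then have "A i \<le> ennreal y * ennreal (\<rho> i)" using L(2)[of i] dy_nonneg[OF y] \<rho>[of i]
          by (simp add: H_def ennreal_mult)
        then show "(\<integral>\<^sup>+y\<in>{2 * a i - b i..2 * b i - a i} \<times> {2 * c i - d i..2 * d i - c i}. U y \<partial>lborel)
            \<le> ennreal y * ennreal ((b i - a i) * (d i - c i))" by (simp add: A_def \<rho>_def)
      qed (use F sq finH in \<open>auto simp: H_def\<close>)
      \<comment> \<open>Restricting \<open>g\<close> to \<open>\<Omega> y\<close> does not affect
        its averages over the rectangles of the group, which lie in \<open>\<Omega> y\<close>, and
        confines the bound to that set.\<close>
      have "emeasure lborel (\<Omega> y) \<le> 216 * (\<integral>\<^sup>+x. ennreal (g x * indicator (\<Omega> y) x * (1 + log_plus (g x * indicator (\<Omega> y) x))) \<partial>lborel)"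
        unfolding \<Omega>_def R_def
      proof (rule strong_weak_type)
        fix i assume i: "i \<in> H y"
        then have "ennreal ((b i - a i) * (d i - c i)) \<le> (\<integral>\<^sup>+x\<in>R i. ennreal (g x) \<partial>lborel)"
          using avg[of i] by (simp add: H_def R_def)
        also have "\<dots> \<le> (\<integral>\<^sup>+x\<in>R i. ennreal (g x * indicator (\<Union>i\<in>H y. R i) x) \<partial>lborel)"
          using i by (intro nn_integral_mono) (auto simp: indicator_def)
        finally show "ennreal ((b i - a i) * (d i - c i))
          \<le> (\<integral>\<^sup>+x\<in>{a i..b i} \<times> {c i..d i}. ennreal (g x * indicator (\<Union>i\<in>H y. {a i..b i} \<times> {c i..d i}) x) \<partial>lborel)"
          by (simp add: R_def)
      next
        have "(\<lambda>x. g x * indicator (\<Omega> y) x) \<in> borel_measurable borel" by measurable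
        then show "(\<lambda>x. g x * indicator (\<Union>i\<in>H y. {a i..b i} \<times> {c i..d i}) x) \<in> borel_measurable borel"
          by (simp add: \<Omega>_def R_def)
      qed (use F finH g in \<open>auto simp: H_def\<close>)
      also have "(\<integral>\<^sup>+x. ennreal (g x * indicator (\<Omega> y) x * (1 + log_plus (g x * indicator (\<Omega> y) x))) \<partial>lborel) = (\<integral>\<^sup>+x\<in>\<Omega> y. \<Phi> x \<partial>lborel)"
        by (intro nn_integral_cong) (auto simp: \<Phi>_def indicator_def)
      finally have 2: "emeasure lborel (\<Omega> y) \<le> 216 * (\<integral>\<^sup>+x\<in>\<Omega> y. \<Phi> x \<partial>lborel)" .
      have "(\<integral>\<^sup>+x\<in>\<Omega> y. w x \<partial>lborel) \<le> 72 * ennreal y * (216 * (\<integral>\<^sup>+x\<in>\<Omega> y. \<Phi> x \<partial>lborel))"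
        by (intro order_trans[OF 1] mult_left_mono 2) auto
      then show ?thesis by (simp add: mult_ac)
    qed
    have layers: "(\<Sum>y\<in>L ` F. ennreal y * (\<Phi> x * indicator (\<Omega> y) x)) \<le> 36 * (\<Phi> x * W x)" for x
    proof -
      define B where "B = {y\<in>L ` F. x \<in> \<Omega> y}"
      have B: "finite B" "B \<subseteq> dyadic_powers" using F L by (auto simp: B_def)
      \<comment> \<open>The level is at most twice the ratio of \<open>A i\<close> to
        \<open>\<rho> i\<close> for a rectangle of the group through \<open>x\<close>, and this
        ratio is at most \<open>9 * W x\<close>.\<close>
      have le: "ennreal y \<le> 18 * W x" if yB: "y \<in> B" for y
      proof -
        obtain i where i: "i \<in> F" "L i = y" "x \<in> R i" using yB by (auto simp: B_def \<Omega>_def H_def)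
        have y: "0 \<le> y" using yB B dy_nonneg by auto
        have "ennreal (\<rho> i) * ennreal y = ennreal (L i * \<rho> i)"
          using i y less_imp_le[OF \<rho>[OF i(1)]] by (simp add: ennreal_mult mult.commute)
        also have "\<dots> \<le> 2 * A i" by (intro L i)
        also have "\<dots> \<le> 2 * (9 * ennreal (\<rho> i) * W x)" by (intro mult_left_mono AW i) auto
        also have "\<dots> = ennreal (\<rho> i) * (18 * W x)" by (simp add: mult_ac)
        finally show ?thesis using \<rho>[OF i(1)]
          by (subst (asm) ennreal_mult_le_mult_iff) auto
      qed
      have "(\<Sum>y\<in>B. ennreal y) \<le> 36 * W x"
      proof (cases "B = {}")
        case False
        then have M: "Max B \<in> B" using B by simp
        have "(\<Sum>y\<in>B. ennreal y) = ennreal (\<Sum>B)"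
          using B dy_nonneg by (subst sum_ennreal) auto
        also have "\<dots> \<le> ennreal (2 * Max B)"
          using B M dy_nonneg by (intro ennreal_leI sum_dyadic_powers_le) auto
        also have "\<dots> = 2 * ennreal (Max B)" using B M dy_nonneg by (subst ennreal_mult) auto
        also have "\<dots> \<le> 2 * (18 * W x)" by (intro mult_left_mono le M) auto
        finally show ?thesis by (simp add: mult.assoc[symmetric])
      qed auto
      moreover have "(\<Sum>y\<in>L ` F. ennreal y * (\<Phi> x * indicator (\<Omega> y) x)) = \<Phi> x * (\<Sum>y\<in>B. ennreal y)"
      proof -
        have "(\<Sum>y\<in>L ` F. ennreal y * (\<Phi> x * indicator (\<Omega> y) x)) = (\<Sum>y\<in>B. ennreal y * (\<Phi> x * indicator (\<Omega> y) x))"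
          using F by (intro sum.mono_neutral_right) (auto simp: B_def)
        also have "\<dots> = (\<Sum>y\<in>B. \<Phi> x * ennreal y)"
          by (intro sum.cong) (auto simp: B_def mult.commute)
        finally show ?thesis by (simp add: sum_distrib_left)
      qed
      ultimately have "(\<Sum>y\<in>L ` F. ennreal y * (\<Phi> x * indicator (\<Omega> y) x)) \<le> \<Phi> x * (36 * W x)"
        by (simp only:) (rule mult_left_mono; simp)
      then show ?thesis by (simp only: mult_ac)
    qed
    \<comment> \<open>\<open>W\<close> need not be measurable, so constants cannot be pulled out of \<open>\<integral> \<Phi> W\<close>; \<open>s\<close> is a measurable minorant.\<close>
    define s where "s x = ennreal (1 / 36) * (\<Sum>y\<in>L ` F. ennreal y * (\<Phi> x * indicator (\<Omega> y) x))" for x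
    have 36: "ennreal (1 / 36) * 36 = 1" "36 * ennreal (1 / 36) = 1"
      by (simp_all add: ennreal_mult''[symmetric] flip: ennreal_numeral)
    have s_le: "s x \<le> \<Phi> x * W x" for x
      using mult_left_mono[OF layers[of x], of "ennreal (1 / 36)"]
      by (simp add: s_def mult.assoc[symmetric] 36)
    have s_eq: "(\<Sum>y\<in>L ` F. ennreal y * (\<Phi> x * indicator (\<Omega> y) x)) = 36 * s x" for x
      by (simp add: s_def mult.assoc[symmetric] 36)
    have [measurable]: "s \<in> borel_measurable borel" unfolding s_def by measurable
    have "(\<Union>i\<in>F. R i) = (\<Union>y\<in>L ` F. \<Omega> y)" by (auto simp: \<Omega>_def H_def)
    then have "(\<integral>\<^sup>+y\<in>(\<Union>i\<in>F. R i). w y \<partial>lborel) \<le> (\<Sum>y\<in>L ` F. \<integral>\<^sup>+x\<in>\<Omega> y. w x \<partial>lborel)"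
      using F by (simp only:) (intro nn_integral_UN_le; simp)
    also have "\<dots> \<le> (\<Sum>y\<in>L ` F. 15552 * (ennreal y * (\<integral>\<^sup>+x\<in>\<Omega> y. \<Phi> x \<partial>lborel)))"
      using L by (intro sum_mono fam) auto
    also have "\<dots> = 15552 * (\<Sum>y\<in>L ` F. \<integral>\<^sup>+x. ennreal y * (\<Phi> x * indicator (\<Omega> y) x) \<partial>lborel)"
      by (simp add: sum_distrib_left nn_integral_cmult)
    also have "\<dots> = 15552 * (\<integral>\<^sup>+x. (\<Sum>y\<in>L ` F. ennreal y * (\<Phi> x * indicator (\<Omega> y) x)) \<partial>lborel)"
      by (subst nn_integral_sum) auto
    also have "\<dots> = 15552 * (36 * (\<integral>\<^sup>+x. s x \<partial>lborel))"
      by (simp only: s_eq) (simp add: nn_integral_cmult)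
    also have "\<dots> \<le> 15552 * (36 * (\<integral>\<^sup>+x. \<Phi> x * W x \<partial>lborel))"
      by (intro mult_left_mono nn_integral_mono s_le) auto
    finally show ?thesis by (simp add: R_def \<Phi>_def mult.assoc[symmetric])
  qed
qed

section \<open>Passage to all rectangles\<close>

text \<open>Continuity in \<open>e\<close> at 0. It serves both to show that superlevel sets are
  open and to pass to rational corners.\<close>

lemma enlarge_rectangle:
  fixes p q r :: real and M :: ennreal
  assumes "0 \<le> r" "0 \<le> p" "0 \<le> q" "ennreal (r * (p * q)) < M"
  shows "\<exists>e>0. ennreal (r * ((p + 2 * e) * (q + 2 * e))) < M"
proof -
  have "((\<lambda>e. ennreal (r * ((p + 2 * e) * (q + 2 * e)))) \<longlongrightarrow> ennreal (r * ((p + 2 * 0) * (q + 2 * 0)))) (at_right 0)"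
    by (intro tendsto_intros)
  then have "\<forall>\<^sub>F e in at_right 0. ennreal (r * ((p + 2 * e) * (q + 2 * e))) < M"
    by (rule order_tendstoD(2)) (use assms in simp)
  then have "\<forall>\<^sub>F e in at_right 0. 0 < e \<and> ennreal (r * ((p + 2 * e) * (q + 2 * e))) < M"
    by (simp add: eventually_conj_iff eventually_at_right_less)
  then show ?thesis using eventually_happens'[of "at_right (0::real)"] by auto
qed

text \<open>Only axis-parallel squares enter. This suffices for the hypothesis \<open>sq\<close>,
  stays below \<open>HL_maximal\<close>, and gives open superlevel sets for every \<open>w\<close>,
  hence Borel measurability.\<close>

definition square_maximal :: "(plane \<Rightarrow> ennreal) \<Rightarrow> plane \<Rightarrow> ennreal" where
  "square_maximal w x = (SUP (a, b, l) \<in> {(a, b, l). 0 < l \<and> x \<in> {a..a+l} \<times> {b..b+l}}.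
     ennreal (1 / l^2) * (\<integral>\<^sup>+y\<in>{a..a+l} \<times> {b..b+l}. w y \<partial>lborel))"

lemma square_maximal_ge:
  assumes "0 < l" "x \<in> {a..a+l} \<times> {b..b+l}"
  shows "(\<integral>\<^sup>+y\<in>{a..a+l} \<times> {b..b+l}. w y \<partial>lborel) \<le> ennreal (l^2) * square_maximal w x"
proof -
  have "(\<integral>\<^sup>+y\<in>{a..a+l} \<times> {b..b+l}. w y \<partial>lborel)
      = ennreal (l^2) * (ennreal (1 / l^2) * (\<integral>\<^sup>+y\<in>{a..a+l} \<times> {b..b+l}. w y \<partial>lborel))"
    using assms(1) by (simp add: mult.assoc[symmetric] ennreal_mult''[symmetric])
  also have "\<dots> \<le> ennreal (l^2) * square_maximal w x"
    unfolding square_maximal_def using assms by (intro mult_left_mono SUP_upper2[of "(a, b, l)"]) auto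
  finally show ?thesis .
qed

text \<open>A square with average above \<open>s\<close> keeps this property under a slight
  enlargement, and the interior of the enlarged square is then a neighbourhood of \<open>x\<close>
  inside the superlevel set.\<close>

lemma open_square_maximal_superlevel: "open {x. s < square_maximal w x}"
proof (cases s)
  case (real r)
  show ?thesis
  proof (subst open_subopen, intro ballI)
    fix x assume "x \<in> {x. s < square_maximal w x}"
    then obtain a b l where Q: "0 < l" "x \<in> {a..a+l} \<times> {b..b+l}"
      "s < ennreal (1 / l^2) * (\<integral>\<^sup>+y\<in>{a..a+l} \<times> {b..b+l}. w y \<partial>lborel)"
      by (auto simp: square_maximal_def less_SUP_iff)
    let ?I = "\<integral>\<^sup>+y\<in>{a..a+l} \<times> {b..b+l}. w y \<partial>lborel"
    have "ennreal (l^2) * s < ennreal (l^2) * (ennreal (1 / l^2) * ?I)"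
      using Q by (intro ennreal_mult_strict_left_mono) auto
    also have "\<dots> = ?I"
      using Q(1) by (simp add: mult.assoc[symmetric] ennreal_mult''[symmetric])
    finally have lt: "ennreal (r * (l * l)) < ?I"
      using real ennreal_mult[of r "l * l"] by (simp add: power2_eq_square mult.commute[of _ "ennreal r"])
    obtain e where e: "0 < e" "ennreal (r * ((l + 2 * e) * (l + 2 * e))) < ?I"
      using enlarge_rectangle[OF _ _ _ lt] real(1) Q(1) by auto
    let ?L = "l + 2 * e"
    let ?I' = "\<integral>\<^sup>+y\<in>{a-e..a-e+?L} \<times> {b-e..b-e+?L}. w y \<partial>lborel"
    have "?I \<le> ?I'" using e by (intro nn_set_integral_set_mono) auto
    with e have I': "ennreal (r * (?L * ?L)) < ?I'" by order
    have "{a-e<..<a-e+?L} \<times> {b-e<..<b-e+?L} \<subseteq> {x. s < square_maximal w x}"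
    proof
      fix z assume z: "z \<in> {a-e<..<a-e+?L} \<times> {b-e<..<b-e+?L}"
      have "?I' \<le> ennreal (?L^2) * square_maximal w z"
        using z Q e by (intro square_maximal_ge) auto
      with I' have "ennreal (?L^2) * s < ennreal (?L^2) * square_maximal w z"
        using real ennreal_mult[of r "?L * ?L"] by (simp add: power2_eq_square mult.commute[of _ "ennreal r"])
      then have "s < square_maximal w z" by (meson mult_left_mono not_le zero_le)
      then show "z \<in> {x. s < square_maximal w x}" by simp
    qed
    moreover have "x \<in> {a-e<..<a-e+?L} \<times> {b-e<..<b-e+?L}" using Q e by auto
    ultimately show "\<exists>T. open T \<and> x \<in> T \<and> T \<subseteq> {x. s < square_maximal w x}"
      by (intro exI[of _ "{a-e<..<a-e+?L} \<times> {b-e<..<b-e+?L}"]) (auto intro!: open_Times)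
  qed
qed auto

lemma borel_measurable_square_maximal [measurable]: "square_maximal w \<in> borel_measurable borel"
  by (rule borel_measurableI_greater) (use open_square_maximal_superlevel in auto)

section \<open>Comparison with the operators of the theorem\<close>

lemma locally_integrable_borel_measurable:
  assumes "locally_integrable f"
  shows "f \<in> borel_measurable lebesgue"
proof (rule borel_measurable_LIMSEQ_real)
  show "(\<lambda>n. indicator (cball 0 (real n)) x *\<^sub>R f x) \<longlonglongrightarrow> f x" for x
  proof (rule tendsto_eventually)
    obtain N where "norm x \<le> real N" using real_arch_simple by blast
    then show "\<forall>\<^sub>F n in sequentially. indicator (cball 0 (real n)) x *\<^sub>R f x = f x"
      by (intro eventually_sequentiallyI[of N]) (auto simp: indicator_def)
  qed
  show "(\<lambda>x. indicator (cball 0 (real n)) x *\<^sub>R f x) \<in> borel_measurable lebesgue" for n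
    using assms by (auto simp: locally_integrable_def set_integrable_def dest!: spec[of _ "cball 0 (real n)"])
qed

lemma nn_integral_lebesgue_cong:
  assumes "AE x in lborel. f x = g x"
  shows "(\<integral>\<^sup>+x. f x \<partial>lebesgue) = (\<integral>\<^sup>+x. g x \<partial>lborel)"
  using nn_integral_cong_AE[OF assms] by (simp add: nn_integral_completion)

text \<open>Axis-parallel squares are cubes, by the identity isometry, and a change on a null set
  alters no integral.\<close>

lemma square_maximal_le_HL_maximal:
  assumes "AE x in lborel. w x = w' x"
  shows "square_maximal w' x \<le> HL_maximal w x"
  unfolding square_maximal_def
proof (rule SUP_least, clarify)
  fix a b l :: real and x1 x2 assume l: "0 < l" and x: "x1 \<in> {a..a+l}" "x2 \<in> {b..b+l}"
  let ?Q = "{a..a+l} \<times> {b..b+l}"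
  have "(\<integral>\<^sup>+y\<in>?Q. w y \<partial>lebesgue) = (\<integral>\<^sup>+y\<in>?Q. w' y \<partial>lborel)"
    using assms by (intro nn_integral_lebesgue_cong) auto
  moreover have "emeasure lebesgue ?Q = ennreal (l^2)"
    using l by (simp add: emeasure_rectangle power2_eq_square)
  ultimately have "ennreal (1 / l^2) * (\<integral>\<^sup>+y\<in>?Q. w' y \<partial>lborel)
      = indicator ?Q (x1, x2) * ((\<integral>\<^sup>+y\<in>?Q. w y \<partial>lebesgue) / emeasure lebesgue ?Q)"
    using l x by (simp add: divide_ennreal_def inverse_ennreal mult.commute inverse_eq_divide)
  also have "\<dots> \<le> HL_maximal w (x1, x2)"
    unfolding maximal_operator_def
  proof (rule SUP_upper)
    show "?Q \<in> cubes"
      unfolding cubes_def mem_Collect_eq using l orthogonal_transformation_id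
      by (intro exI[of _ "\<lambda>x::plane. x"], rule_tac exI[of _ a], rule_tac exI[of _ b], rule_tac exI[of _ l]) simp
  qed
  finally show "ennreal (1 / l\<^sup>2) * (\<integral>\<^sup>+y\<in>?Q. w' y \<partial>lborel) \<le> HL_maximal w (x1, x2)" .
qed

lemma strong_maximal_ge:
  assumes "a < b" "c < d" "x \<in> {a..b} \<times> {c..d}"
  shows "(\<integral>\<^sup>+y\<in>{a..b} \<times> {c..d}. v y \<partial>lebesgue) \<le> ennreal ((b - a) * (d - c)) * strong_maximal v x"
proof -
  let ?R = "{a..b} \<times> {c..d}" and ?r = "(b - a) * (d - c)"
  have r: "0 < ?r" using assms by simp
  have "(\<integral>\<^sup>+y\<in>?R. v y \<partial>lebesgue) = ennreal ?r * ((\<integral>\<^sup>+y\<in>?R. v y \<partial>lebesgue) / ennreal ?r)"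
    using r by (subst ennreal_times_divide, subst mult.commute, subst ennreal_mult_divide_eq) auto
  also have "\<dots> \<le> ennreal ?r * strong_maximal v x"
  proof (intro mult_left_mono)
    have "(\<integral>\<^sup>+y\<in>?R. v y \<partial>lebesgue) / ennreal ?r = indicator ?R x * ((\<integral>\<^sup>+y\<in>?R. v y \<partial>lebesgue) / emeasure lebesgue ?R)"
      using assms by (simp add: emeasure_rectangle)
    also have "\<dots> \<le> strong_maximal v x"
      unfolding maximal_operator_def using assms by (intro SUP_upper) (auto simp: rectangles_def)
    finally show "(\<integral>\<^sup>+y\<in>?R. v y \<partial>lebesgue) / ennreal ?r \<le> strong_maximal v x" .
  qed simp
  finally show ?thesis .
qed

text \<open>Rational coordinates make the family countable. With \<open>v\<close> equal to
  \<open>\<bar>f\<bar> / t\<close> it covers the set where the strong maximal function of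
  \<open>f\<close> exceeds \<open>t\<close>.\<close>

definition rational_rectangles :: "(plane \<Rightarrow> ennreal) \<Rightarrow> (real \<times> real \<times> real \<times> real) set" where
  "rational_rectangles v = {(a, b, c, d) \<in> \<rat> \<times> \<rat> \<times> \<rat> \<times> \<rat>. a < b \<and> c < d \<and>
     ennreal ((b - a) * (d - c)) \<le> (\<integral>\<^sup>+y\<in>{a..b} \<times> {c..d}. v y \<partial>lborel)}"

lemma countable_rational_rectangles: "countable (rational_rectangles v)"
  by (rule countable_subset[of _ "\<rat> \<times> \<rat> \<times> \<rat> \<times> \<rat>"])
     (auto simp: rational_rectangles_def countable_rat)

text \<open>If \<open>u\<close> has average above \<open>t\<close> on a rectangle, the integral of
  \<open>v\<close> there strictly exceeds the area. So there is room for a slightly larger rational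
  rectangle whose area is still below that integral.\<close>

lemma strong_maximal_superlevel_subset:
  fixes t :: real
  assumes "0 < t" and v: "AE x in lborel. u x = ennreal t * v x" and x: "ennreal t < strong_maximal u x"
    and [measurable]: "v \<in> borel_measurable borel"
  shows "\<exists>(a, b, c, d)\<in>rational_rectangles v. x \<in> {a..b} \<times> {c..d}"
proof -
  obtain a b c d where R: "a < b" "c < d" "ennreal t < indicator ({a..b} \<times> {c..d}) x *
      ((\<integral>\<^sup>+y\<in>{a..b} \<times> {c..d}. u y \<partial>lebesgue) / emeasure lebesgue ({a..b} \<times> {c..d}))"
    using x by (auto simp: maximal_operator_def less_SUP_iff rectangles_def)
  let ?I = "\<integral>\<^sup>+y\<in>{a..b} \<times> {c..d}. v y \<partial>lborel" and ?r = "(b - a) * (d - c)"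
  have xR: "x \<in> {a..b} \<times> {c..d}"
  proof (rule ccontr)
    assume "x \<notin> {a..b} \<times> {c..d}"
    then show False using R(3) by simp
  qed
  have "(\<integral>\<^sup>+y\<in>{a..b} \<times> {c..d}. u y \<partial>lebesgue) = (\<integral>\<^sup>+y. ennreal t * (v y * indicator ({a..b} \<times> {c..d}) y) \<partial>lborel)"
    using v by (intro nn_integral_lebesgue_cong) (auto simp: mult_ac)
  also have "\<dots> = ennreal t * ?I" by (simp add: nn_integral_cmult)
  finally have tI: "ennreal t < ennreal t * ?I / ennreal ?r"
    using R xR by (simp add: emeasure_rectangle)
  have lt: "ennreal (1 * ?r) < ?I"
  proof (rule ccontr)
    assume "\<not> ennreal (1 * ?r) < ?I"
    then have "ennreal t * ?I / ennreal ?r \<le> ennreal t * ennreal ?r / ennreal ?r"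
      by (intro divide_right_mono_ennreal mult_left_mono) auto
    also have "\<dots> = ennreal t" using R by (intro ennreal_mult_divide_eq) auto
    finally show False using tI by simp
  qed
  obtain e where e: "0 < e" "ennreal (1 * ((b - a + 2 * e) * (d - c + 2 * e))) < ?I"
    using enlarge_rectangle[OF _ _ _ lt] R by auto
  obtain a' b' c' d' where q: "a' \<in> \<rat>" "a - e < a'" "a' < a" "b' \<in> \<rat>" "b < b'" "b' < b + e"
    "c' \<in> \<rat>" "c - e < c'" "c' < c" "d' \<in> \<rat>" "d < d'" "d' < d + e"
    using e Rats_dense_in_real[of "a - e" a] Rats_dense_in_real[of b "b + e"]
      Rats_dense_in_real[of "c - e" c] Rats_dense_in_real[of d "d + e"] by auto
  have "ennreal ((b' - a') * (d' - c')) \<le> ennreal (1 * ((b - a + 2 * e) * (d - c + 2 * e)))"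
    using q R e by (intro ennreal_leI) (auto intro!: mult_mono)
  also have "\<dots> \<le> ?I" using e by simp
  also have "\<dots> \<le> (\<integral>\<^sup>+y\<in>{a'..b'} \<times> {c'..d'}. v y \<partial>lborel)"
    using q by (intro nn_set_integral_set_mono) auto
  finally have "(a', b', c', d') \<in> rational_rectangles v"
    using q R by (simp add: rational_rectangles_def)
  moreover have "x \<in> {a'..b'} \<times> {c'..d'}" using xR q by auto
  ultimately show ?thesis by auto
qed

theorem theorem1p2:
  shows "\<exists>C::real. C > 0 \<and>
    (\<forall>(w :: plane \<Rightarrow> real) (f :: plane \<Rightarrow> real) (t :: real).
       weight w \<longrightarrow> locally_integrable f \<longrightarrow> t > 0 \<longrightarrow>
         weight_of w {x. strong_maximal (\<lambda>y. ennreal \<bar>f y\<bar>) x > ennreal t}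
         \<le> ennreal C *
           (\<integral>\<^sup>+x. ennreal (\<bar>f x\<bar> / t * (1 + log_plus (\<bar>f x\<bar> / t)))
                 * strong_maximal (HL_maximal (\<lambda>y. ennreal (w y))) x \<partial>lebesgue))"
proof (intro exI[of _ 559872] conjI allI impI)
  fix w f :: "plane \<Rightarrow> real" and t :: real
  assume w: "weight w" and f: "locally_integrable f" and t: "0 < t"
  define W where "W = strong_maximal (HL_maximal (\<lambda>y. ennreal (w y)))"
  \<comment> \<open>Borel representatives of \<open>w\<close> and \<open>f\<close> replace them in
    all integrals, as they agree almost everywhere.\<close>
  obtain w\<^sub>0 where w\<^sub>0[measurable]: "w\<^sub>0 \<in> borel_measurable lborel" and w_eq: "AE x in lborel. w x = w\<^sub>0 x"
    using completion_ex_borel_measurable_real locally_integrable_borel_measurable w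
    unfolding weight_def by blast
  obtain f\<^sub>0 where f\<^sub>0[measurable]: "f\<^sub>0 \<in> borel_measurable lborel" and f_eq: "AE x in lborel. f x = f\<^sub>0 x"
    using completion_ex_borel_measurable_real locally_integrable_borel_measurable f by blast
  define v where "v x = ennreal (w\<^sub>0 x)" for x
  define g where "g x = \<bar>f\<^sub>0 x\<bar> / t" for x
  have [measurable]: "v \<in> borel_measurable borel" "g \<in> borel_measurable borel"
    using w\<^sub>0 f\<^sub>0 unfolding v_def g_def by simp_all
  have g: "0 \<le> g x" for x using t by (simp add: g_def)
  have v_eq: "AE x in lborel. ennreal (w x) = v x" using w_eq by (auto simp: v_def)
  define U where "U = square_maximal v"
  have [measurable]: "U \<in> borel_measurable borel" by (simp add: U_def)
  define D where "D = rational_rectangles (\<lambda>x. ennreal (g x))"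
  define X where "X = (\<lambda>(a, b, c, d). {a..b} \<times> {c..d::real} :: plane set)"
  let ?RHS = "\<integral>\<^sup>+x. ennreal (g x * (1 + log_plus (g x))) * W x \<partial>lborel"
  have X[measurable]: "X R \<in> sets borel" for R by (auto simp: X_def split: prod.split)
  have finite_case: "(\<integral>\<^sup>+x\<in>(\<Union>R\<in>F. X R). v x \<partial>lborel) \<le> 559872 * ?RHS" if F: "finite F" "F \<subseteq> D" for F
  proof -
    have F': "fst R < fst (snd R)" "fst (snd (snd R)) < snd (snd (snd R))"
      "ennreal ((fst (snd R) - fst R) * (snd (snd (snd R)) - fst (snd (snd R))))
        \<le> (\<integral>\<^sup>+x\<in>{fst R..fst (snd R)} \<times> {fst (snd (snd R))..snd (snd (snd R))}. ennreal (g x) \<partial>lborel)"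
      if "R \<in> F" for R
      using that F by (auto simp: D_def rational_rectangles_def)
    have "(\<integral>\<^sup>+x\<in>(\<Union>R\<in>F. {fst R..fst (snd R)} \<times> {fst (snd (snd R))..snd (snd (snd R))}). v x \<partial>lborel) \<le> 559872 * ?RHS"
    proof (rule finite_rectangle_estimate[where U = U and a = fst and b = "\<lambda>R. fst (snd R)"
          and c = "\<lambda>R. fst (snd (snd R))" and d = "\<lambda>R. snd (snd (snd R))"])
      fix R x assume R: "R \<in> F" and x: "x \<in> {fst R..fst (snd R)} \<times> {fst (snd (snd R))..snd (snd (snd R))}"
      obtain a b c d where Rabcd: "R = (a, b, c, d)" by (cases R)
      have ab: "a < b" "c < d" using F'(1,2)[OF R] by (auto simp: Rabcd)
      \<comment> \<open>The tripled rectangle still contains \<open>x\<close> and has 9 times the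
        area, so \<open>W x\<close> controls its average of \<open>HL_maximal\<close>, which
        dominates \<open>U\<close>.\<close>
      let ?T = "{2 * a - b..2 * b - a} \<times> {2 * c - d..2 * d - c}"
      have "(\<integral>\<^sup>+y\<in>?T. U y \<partial>lborel) = (\<integral>\<^sup>+y\<in>?T. U y \<partial>lebesgue)" by (simp add: nn_integral_completion)
      also have "\<dots> \<le> (\<integral>\<^sup>+y\<in>?T. HL_maximal (\<lambda>y. ennreal (w y)) y \<partial>lebesgue)"
        unfolding U_def by (intro nn_integral_mono mult_right_mono square_maximal_le_HL_maximal v_eq) auto
      also have "\<dots> \<le> ennreal ((2 * b - a - (2 * a - b)) * (2 * d - c - (2 * c - d))) * W x"
        unfolding W_def using ab x by (intro strong_maximal_ge) (auto simp: Rabcd)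
      also have "(2 * b - a - (2 * a - b)) * (2 * d - c - (2 * c - d)) = 9 * ((b - a) * (d - c))"
        by (simp add: algebra_simps)
      also have "ennreal \<dots> = 9 * ennreal ((b - a) * (d - c))"
        using ab by (simp add: ennreal_mult')
      finally show "(\<integral>\<^sup>+y\<in>{2 * fst R - fst (snd R)..2 * fst (snd R) - fst R} \<times>
          {2 * fst (snd (snd R)) - snd (snd (snd R))..2 * snd (snd (snd R)) - fst (snd (snd R))}. U y \<partial>lborel)
        \<le> 9 * ennreal ((fst (snd R) - fst R) * (snd (snd (snd R)) - fst (snd (snd R)))) * W x"
        by (simp add: Rabcd)
    qed (use F F' g in \<open>auto simp: U_def intro: square_maximal_ge\<close>)
    moreover have "(\<Union>R\<in>F. X R) = (\<Union>R\<in>F. {fst R..fst (snd R)} \<times> {fst (snd (snd R))..snd (snd (snd R))})"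
      by (auto simp: X_def split: prod.splits)
    ultimately show ?thesis by simp
  qed
  let ?\<nu> = "density lborel v"
  have \<nu>: "emeasure ?\<nu> A = (\<integral>\<^sup>+x\<in>A. v x \<partial>lborel)" if "A \<in> sets borel" for A
    using that by (subst emeasure_density) auto
  have countable_case: "(\<integral>\<^sup>+x\<in>(\<Union>R\<in>D. X R). v x \<partial>lborel) \<le> 559872 * ?RHS"
  proof (cases "D = {}")
    case False
    \<comment> \<open>The finite unions \<open>Y n\<close> exhaust the countable union; as the bound
      for them does not depend on \<open>n\<close>, continuity from below of the measure
      \<open>?\<nu>\<close> carries it over.\<close>
    define Y where "Y n = (\<Union>R\<in>from_nat_into D ` {..<n}. X R)" for n :: nat
    have [measurable]: "Y n \<in> sets borel" for n unfolding Y_def by auto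
    have D: "(\<Union>R\<in>D. X R) = (\<Union>n. Y n)"
    proof -
      have "range (from_nat_into D) = D"
        using range_from_nat_into[OF False] countable_rational_rectangles by (simp add: D_def)
      then have "(\<Union>R\<in>D. X R) = (\<Union>n. X (from_nat_into D n))" by (metis image_image)
      also have "\<dots> = (\<Union>n. Y n)" by (auto simp: Y_def)
      finally show ?thesis .
    qed
    have "(\<integral>\<^sup>+x\<in>(\<Union>R\<in>D. X R). v x \<partial>lborel) = emeasure ?\<nu> (\<Union>n. Y n)"
      unfolding D by (subst \<nu>) auto
    also have "\<dots> = (SUP n. emeasure ?\<nu> (Y n))"
    proof (rule SUP_emeasure_incseq[symmetric])
      show "incseq Y" unfolding Y_def incseq_def by (intro allI impI UN_mono image_mono) auto
    qed auto
    also have "\<dots> \<le> 559872 * ?RHS"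
    proof (rule SUP_least)
      fix n
      have "(\<integral>\<^sup>+x\<in>Y n. v x \<partial>lborel) \<le> 559872 * ?RHS"
        unfolding Y_def using from_nat_into[OF False] by (intro finite_case) auto
      then show "emeasure ?\<nu> (Y n) \<le> 559872 * ?RHS" by (subst \<nu>) auto
    qed
    finally show ?thesis .
  qed simp
  have "{x. strong_maximal (\<lambda>y. ennreal \<bar>f y\<bar>) x > ennreal t} \<subseteq> (\<Union>R\<in>D. X R)"
  proof clarify
    fix x assume x: "ennreal t < strong_maximal (\<lambda>y. ennreal \<bar>f y\<bar>) x"
    have "AE x in lborel. ennreal \<bar>f x\<bar> = ennreal t * ennreal (g x)"
      using f_eq t by (auto simp: g_def ennreal_mult''[symmetric])
    from strong_maximal_superlevel_subset[OF t this x] show "x \<in> (\<Union>R\<in>D. X R)"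
      by (fastforce simp: D_def X_def)
  qed
  then have "weight_of w {x. strong_maximal (\<lambda>y. ennreal \<bar>f y\<bar>) x > ennreal t}
      \<le> (\<integral>\<^sup>+x\<in>(\<Union>R\<in>D. X R). ennreal (w x) \<partial>lebesgue)"
    unfolding weight_of_def by (rule nn_set_integral_set_mono)
  also have "\<dots> = (\<integral>\<^sup>+x\<in>(\<Union>R\<in>D. X R). v x \<partial>lborel)"
    using v_eq by (intro nn_integral_lebesgue_cong) auto
  also note countable_case
  also have "?RHS = (\<integral>\<^sup>+x. ennreal (\<bar>f x\<bar> / t * (1 + log_plus (\<bar>f x\<bar> / t))) * W x \<partial>lebesgue)"
    using f_eq by (intro nn_integral_lebesgue_cong[symmetric]) (auto simp: g_def)
  finally show "weight_of w {x. strong_maximal (\<lambda>y. ennreal \<bar>f y\<bar>) x > ennreal t}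
      \<le> ennreal 559872 * (\<integral>\<^sup>+x. ennreal (\<bar>f x\<bar> / t * (1 + log_plus (\<bar>f x\<bar> / t)))
                 * strong_maximal (HL_maximal (\<lambda>y. ennreal (w y))) x \<partial>lebesgue)"
    by (simp add: W_def)
qed simp

end
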